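(* Let $\phi:N^2\to\mathbb{R}^3$ be an elliptic or hyperbolic affine sphere, scaled such that the absolute value of its affine mean curvature equals $1$. Let $\gamma=(\gamma_1,\gamma_2):I\to\mathbb{R}^2$ be a curve such that $$F(t,u,v)=(\gamma_1(t),\gamma_2(t)\phi(u,v)),\qquad (t,(u,v))\in I\times N^2,$$ defines a positive definite affine hypersurface of $\mathbb{R}^4$. Then $F$ admits a pointwise $Z_3$- or $SO(2)$-symmetry.
   Context: A nondegenerate affine hypersurface $F:M^3\to\mathbb{R}^4$ is an immersion with (equi)affine (Blaschke) normal field $\xi$, inducing $\nabla$, $h$, $S$ by $D_XY=\nabla_XY+h(X,Y)\xi$, $D_X\xi=-SX$ ($D$ the flat connection of $\mathbb{R}^4$), where $h$ (affine metric) is nondegenerate and $|\det(X_1,X_2,X_3,\xi)|=1$ for $h$-orthonormal $X_1,X_2,X_3$; $S$ is the affine shape operator. The difference tensor is $K(X,Y)=\nabla_XY-\widehat\nabla_XY$ ($\widehat\nabla$ the Levi-Civita connection of $h$). Positive definite means $h$ is positive definite. An elliptic or hyperbolic affine sphere $\phi:N^2\to\mathbb{R}^3$ is here a proper affine sphere centred at the origin, i.e. a nondegenerate affine surface whose affine normal is a nonzero constant multiple $-H\phi$ of the position vector, $H$ being its affine mean curvature (so $|H|=1$ after scaling). $F$ admits a pointwise $G$-symmetry ($G=Z_3$ or $SO(2)$) if at every point $p$ there is a subgroup of the orientation-preserving linear isometries of $(T_pM,h)$, consisting of the rotations about some axis by multiples of $2\pi/3$ (for $Z_3$) or by all angles (for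 $SO(2)$), each element $g$ of which satisfies $K(gX,gY)=gK(X,Y)$ and $S(gX)=gS(X)$ for all $X,Y\in T_pM$. *)

theory Defs
  imports "HOL-Analysis.Analysis"
begin

section \<open>Smooth maps and smooth manifolds\<close>

fun differentiable_upto ::
  "nat \<Rightarrow> 'a::euclidean_space set \<Rightarrow> ('a \<Rightarrow> 'b::euclidean_space) \<Rightarrow> bool" where
  "differentiable_upto 0 S f \<longleftrightarrow> continuous_on S f"
| "differentiable_upto (Suc k) S f \<longleftrightarrow>
     (\<forall>p\<in>S. f differentiable (at p)) \<and>
     (\<forall>v. differentiable_upto k S (\<lambda>p. frechet_derivative f (at p) v))"

text \<open>Class \<open>C\<^sup>\<infinity>\<close>; meant for open \<open>S\<close>, since the derivatives are taken at full neighbourhoods.\<close>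

definition smooth_on :: "'a::euclidean_space set \<Rightarrow> ('a \<Rightarrow> 'b::euclidean_space) \<Rightarrow> bool" where
  "smooth_on S f \<longleftrightarrow> (\<forall>k. differentiable_upto k S f)"

text \<open>
  An atlas is a set of local parametrizations \<open>(V, x)\<close>: the coordinate domain \<open>V\<close> is open in
  \<open>\<real>\<^sup>m\<close> and \<open>x\<close> maps it homeomorphically onto an open subset of the manifold; values of \<open>x\<close>
  outside \<open>V\<close> are irrelevant.  The atlas need not be maximal.
\<close>

type_synonym ('a, 'm) atlas = "((real^'m) set \<times> (real^'m \<Rightarrow> 'a)) set"

definition smooth_manifold :: "'a topology \<Rightarrow> ('a, 'm::finite) atlas \<Rightarrow> bool" where
  "smooth_manifold N A \<longleftrightarrow>
     Hausdorff_space N \<and> second_countable N \<and>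
     (\<forall>(V, x)\<in>A. open V \<and> openin N (x ` V) \<and>
        homeomorphic_map (top_of_set V) (subtopology N (x ` V)) x) \<and>
     (\<Union>(V, x)\<in>A. x ` V) = topspace N \<and>
     (\<forall>(V, x)\<in>A. \<forall>(W, y)\<in>A. smooth_on {p \<in> V. x p \<in> y ` W} (inv_into W y \<circ> x))"

text \<open>The product atlas on \<open>I \<times> N\<close>, for \<open>I\<close> open in \<open>\<real>\<close> and a surface \<open>N\<close>, with coordinates \<open>(t, u, v)\<close>.\<close>

definition product_atlas :: "real set \<Rightarrow> ('a, 2) atlas \<Rightarrow> (real \<times> 'a, 3) atlas" where
  "product_atlas I A =
     (\<lambda>(V, x). ({y. y$1 \<in> I \<and> vector [y$2, y$3] \<in> V},
                \<lambda>y. (y$1, x (vector [y$2, y$3])))) ` A"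

section \<open>Affine hypersurfaces in a coordinate domain\<close>

text \<open>
  Here \<open>f\<close> is an immersion of a coordinate domain and \<open>\<xi>\<close> a field along it, both written in the
  coordinates, and the tangent space at a point \<open>p\<close> is identified with \<open>\<real>\<^sup>m\<close> through the coordinates.
  A field is transversal at \<open>p\<close> when \<open>(a, c) \<mapsto> df\<^sub>p(a) + c \<xi>\<^sub>p\<close> is bijective;
  inverting this map splits an ambient vector into its tangential and its transversal component.
\<close>

definition gauss_frame ::
  "(real^'m \<Rightarrow> real^'n) \<Rightarrow> (real^'m \<Rightarrow> real^'n) \<Rightarrow> real^'m \<Rightarrow> (real^'m) \<times> real \<Rightarrow> real^'n" where
  "gauss_frame f \<xi> p = (\<lambda>(a, c). frechet_derivative f (at p) a + c *\<^sub>R \<xi> p)"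

definition tangential ::
  "(real^'m \<Rightarrow> real^'n) \<Rightarrow> (real^'m \<Rightarrow> real^'n) \<Rightarrow> real^'m \<Rightarrow> real^'n \<Rightarrow> real^'m" where
  "tangential f \<xi> p w = fst (inv (gauss_frame f \<xi> p) w)"

definition transversal ::
  "(real^'m \<Rightarrow> real^'n) \<Rightarrow> (real^'m \<Rightarrow> real^'n) \<Rightarrow> real^'m \<Rightarrow> real^'n \<Rightarrow> real" where
  "transversal f \<xi> p w = snd (inv (gauss_frame f \<xi> p) w)"

text \<open>
  Gauss formula \<open>D\<^sub>X f\<^sub>*Y = f\<^sub>*(\<nabla>\<^sub>X Y) + h(X, Y) \<xi>\<close> and Weingarten formula \<open>D\<^sub>X \<xi> = - f\<^sub>*(S X)\<close>.
  Tensors are evaluated on tangent vectors at \<open>p\<close> by extending these to constant coordinate fields.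
\<close>

definition induced_connection ::
  "(real^'m \<Rightarrow> real^'n) \<Rightarrow> (real^'m \<Rightarrow> real^'n) \<Rightarrow>
   (real^'m \<Rightarrow> real^'m) \<Rightarrow> (real^'m \<Rightarrow> real^'m) \<Rightarrow> real^'m \<Rightarrow> real^'m" where
  "induced_connection f \<xi> X Y p =
     tangential f \<xi> p
       (frechet_derivative (\<lambda>q. frechet_derivative f (at q) (Y q)) (at p) (X p))"

definition affine_metric ::
  "(real^'m \<Rightarrow> real^'n) \<Rightarrow> (real^'m \<Rightarrow> real^'n) \<Rightarrow> real^'m \<Rightarrow> real^'m \<Rightarrow> real^'m \<Rightarrow> real" where
  "affine_metric f \<xi> p v w =
     transversal f \<xi> p
       (frechet_derivative (\<lambda>q. frechet_derivative f (at q) w) (at p) v)"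

definition shape_operator ::
  "(real^'m \<Rightarrow> real^'n) \<Rightarrow> (real^'m \<Rightarrow> real^'n) \<Rightarrow> real^'m \<Rightarrow> real^'m \<Rightarrow> real^'m" where
  "shape_operator f \<xi> p v = - tangential f \<xi> p (frechet_derivative \<xi> (at p) v)"

definition affine_mean_curvature ::
  "(real^'m \<Rightarrow> real^'n) \<Rightarrow> (real^'m \<Rightarrow> real^'n) \<Rightarrow> real^'m \<Rightarrow> real" where
  "affine_mean_curvature f \<xi> p = trace (matrix (shape_operator f \<xi> p)) / real CARD('m)"

text \<open>
  In coordinates a connection is \<open>dY(X) + \<Gamma>(X, Y)\<close> with \<open>\<Gamma>\<close> bilinear.  It is torsion-free iff \<open>\<Gamma>\<close> is
  symmetric; the second condition on \<open>G\<close> is the compatibility with \<open>h\<close>.  For a nondegenerate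
  symmetric \<open>h\<close> these conditions determine \<open>\<Gamma>\<close> uniquely at each point.
\<close>

definition christoffel ::
  "(real^'m \<Rightarrow> real^'m \<Rightarrow> real^'m \<Rightarrow> real) \<Rightarrow> real^'m \<Rightarrow> real^'m \<Rightarrow> real^'m \<Rightarrow> real^'m" where
  "christoffel h p = (THE G. bilinear G \<and> (\<forall>u v. G u v = G v u) \<and>
     (\<forall>u v w. frechet_derivative (\<lambda>q. h q v w) (at p) u = h p (G u v) w + h p v (G u w)))"

definition levi_civita ::
  "(real^'m \<Rightarrow> real^'m \<Rightarrow> real^'m \<Rightarrow> real) \<Rightarrow>
   (real^'m \<Rightarrow> real^'m) \<Rightarrow> (real^'m \<Rightarrow> real^'m) \<Rightarrow> real^'m \<Rightarrow> real^'m" where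
  "levi_civita h X Y p = frechet_derivative Y (at p) (X p) + christoffel h p (X p) (Y p)"

definition difference_tensor ::
  "(real^'m \<Rightarrow> real^'n) \<Rightarrow> (real^'m \<Rightarrow> real^'n) \<Rightarrow> real^'m \<Rightarrow> real^'m \<Rightarrow> real^'m \<Rightarrow> real^'m" where
  "difference_tensor f \<xi> p v w =
     induced_connection f \<xi> (\<lambda>_. v) (\<lambda>_. w) p
     - levi_civita (affine_metric f \<xi>) (\<lambda>_. v) (\<lambda>_. w) p"

section \<open>Blaschke hypersurfaces and proper affine spheres\<close>

text \<open>\<open>h\<close> may be indefinite, so an orthonormal family satisfies \<open>h(X\<^sub>i, X\<^sub>i) = \<plusminus>1\<close>.\<close>

definition orthonormal_family ::
  "('v \<Rightarrow> 'v \<Rightarrow> real) \<Rightarrow> 'i set \<Rightarrow> ('i \<Rightarrow> 'v) \<Rightarrow> bool" where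
  "orthonormal_family h J X \<longleftrightarrow>
     (\<forall>i\<in>J. \<bar>h (X i) (X i)\<bar> = 1 \<and> (\<forall>j\<in>J. i \<noteq> j \<longrightarrow> h (X i) (X j) = 0))"

text \<open>
  \<open>f\<close> is a nondegenerate affine hypersurface and \<open>\<xi>\<close> its affine (Blaschke) normal field, which is
  determined up to sign.  Bijectivity of the Gauss frame forces \<open>n = m + 1\<close>.  In the volume condition
  the \<open>m\<close> orthonormal vectors are indexed by the rows other than \<open>k\<close>, and \<open>\<xi>\<close> is put in row \<open>k\<close>;
  the order of the rows does not affect the absolute value of the determinant.
\<close>

definition blaschke_hypersurface ::
  "('a, 'm::finite) atlas \<Rightarrow> ('a \<Rightarrow> real^'n) \<Rightarrow> ('a \<Rightarrow> real^'n) \<Rightarrow> bool" where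
  "blaschke_hypersurface A f \<xi> \<longleftrightarrow> (\<forall>(V, x)\<in>A.
     smooth_on V (f \<circ> x) \<and> smooth_on V (\<xi> \<circ> x) \<and>
     (\<forall>p\<in>V.
        inj (frechet_derivative (f \<circ> x) (at p)) \<and>
        bij (gauss_frame (f \<circ> x) (\<xi> \<circ> x) p) \<and>
        (\<forall>v. transversal (f \<circ> x) (\<xi> \<circ> x) p (frechet_derivative (\<xi> \<circ> x) (at p) v) = 0) \<and>
        (\<forall>v. (\<forall>w. affine_metric (f \<circ> x) (\<xi> \<circ> x) p v w = 0) \<longrightarrow> v = 0) \<and>
        (\<forall>k X. orthonormal_family (affine_metric (f \<circ> x) (\<xi> \<circ> x) p) (UNIV - {k}) X \<longrightarrow>
           \<bar>det (\<chi> i. if i = k then \<xi> (x p) else frechet_derivative (f \<circ> x) (at p) (X i))\<bar> = 1)))"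

definition positive_definite ::
  "('a, 'm::finite) atlas \<Rightarrow> ('a \<Rightarrow> real^'n) \<Rightarrow> ('a \<Rightarrow> real^'n) \<Rightarrow> bool" where
  "positive_definite A f \<xi> \<longleftrightarrow>
     (\<forall>(V, x)\<in>A. \<forall>p\<in>V. \<forall>v. v \<noteq> 0 \<longrightarrow> affine_metric (f \<circ> x) (\<xi> \<circ> x) p v v > 0)"

text \<open>
  Centred at the origin.  The Weingarten formula gives \<open>S = H id\<close>, so \<open>H\<close> is the affine mean curvature;
  the sphere is elliptic or hyperbolic according to the sign of \<open>H\<close>.
\<close>

definition proper_affine_sphere ::
  "('a, 2) atlas \<Rightarrow> ('a \<Rightarrow> real^3) \<Rightarrow> ('a \<Rightarrow> real^3) \<Rightarrow> bool" where
  "proper_affine_sphere A \<phi> \<xi> \<longleftrightarrow> blaschke_hypersurface A \<phi> \<xi> \<and>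
     (\<exists>H. H \<noteq> 0 \<and> (\<forall>(V, x)\<in>A. \<forall>p\<in>V. \<xi> (x p) = - H *\<^sub>R \<phi> (x p)))"

section \<open>Pointwise symmetries\<close>

definition special_isometries ::
  "(real^'m \<Rightarrow> real^'m \<Rightarrow> real) \<Rightarrow> (real^'m \<Rightarrow> real^'m) set" where
  "special_isometries h =
     {g. linear g \<and> det (matrix g) > 0 \<and> (\<forall>v w. h (g v) (g w) = h v w)}"

text \<open>
  The rotation by the angle \<open>\<theta>\<close> about the axis spanned by \<open>e 1\<close>, for an \<open>h\<close>-orthonormal basis
  \<open>e 1, e 2, e 3\<close> and positive definite \<open>h\<close>.
\<close>

definition rotation_about ::
  "(real^3 \<Rightarrow> real^3 \<Rightarrow> real) \<Rightarrow> (3 \<Rightarrow> real^3) \<Rightarrow> real \<Rightarrow> real^3 \<Rightarrow> real^3" where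
  "rotation_about h e \<theta> v =
     h v (e 1) *\<^sub>R e 1
     + h v (e 2) *\<^sub>R (cos \<theta> *\<^sub>R e 2 + sin \<theta> *\<^sub>R e 3)
     + h v (e 3) *\<^sub>R (- sin \<theta> *\<^sub>R e 2 + cos \<theta> *\<^sub>R e 3)"

definition pointwise_rotation_symmetry ::
  "real set \<Rightarrow> ('a, 3) atlas \<Rightarrow> ('a \<Rightarrow> real^4) \<Rightarrow> ('a \<Rightarrow> real^4) \<Rightarrow> bool" where
  "pointwise_rotation_symmetry \<Theta> A F \<xi> \<longleftrightarrow> (\<forall>(V, x)\<in>A. \<forall>p\<in>V.
     let h = affine_metric (F \<circ> x) (\<xi> \<circ> x) p;
         K = difference_tensor (F \<circ> x) (\<xi> \<circ> x) p;
         S = shape_operator (F \<circ> x) (\<xi> \<circ> x) p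
     in \<exists>G \<subseteq> special_isometries h.
          (\<exists>e. orthonormal_family h UNIV e \<and> G = rotation_about h e ` \<Theta>) \<and>
          (\<forall>g\<in>G. (\<forall>v w. K (g v) (g w) = g (K v w)) \<and> (\<forall>v. S (g v) = g (S v))))"

definition pointwise_Z3_symmetry ::
  "('a, 3) atlas \<Rightarrow> ('a \<Rightarrow> real^4) \<Rightarrow> ('a \<Rightarrow> real^4) \<Rightarrow> bool" where
  "pointwise_Z3_symmetry = pointwise_rotation_symmetry {2 * pi * of_int k / 3 | k :: int. True}"

definition pointwise_SO2_symmetry ::
  "('a, 3) atlas \<Rightarrow> ('a \<Rightarrow> real^4) \<Rightarrow> ('a \<Rightarrow> real^4) \<Rightarrow> bool" where
  "pointwise_SO2_symmetry = pointwise_rotation_symmetry UNIV"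

section \<open>The hypersurface generated by a curve and a surface\<close>

definition warped_hypersurface ::
  "(real \<Rightarrow> real^2) \<Rightarrow> ('a \<Rightarrow> real^3) \<Rightarrow> real \<times> 'a \<Rightarrow> real^4" where
  "warped_hypersurface \<gamma> \<phi> = (\<lambda>(t, q).
     vector [\<gamma> t $ 1, \<gamma> t $ 2 * \<phi> q $ 1, \<gamma> t $ 2 * \<phi> q $ 2, \<gamma> t $ 2 * \<phi> q $ 3])"

end

theory Submission
  imports Defs
begin

text \<open>
  The covector \<open>\<nu>\<close> that kills the tangent space and takes the value \<open>1\<close> on the affine normal is
  \<open>\<lambda> (- \<gamma>\<^sub>2', \<gamma>\<^sub>1' n)\<close> with \<open>n\<close> the centroaffine conormal of \<open>\<phi>\<close>, so the affine metric is
  \<open>\<lambda> ((\<gamma>\<^sub>1' \<gamma>\<^sub>2'' - \<gamma>\<^sub>2' \<gamma>\<^sub>1'') dt\<^sup>2 + \<gamma>\<^sub>1' \<gamma>\<^sub>2 B)\<close> with \<open>B\<close> the centroaffine metric of \<open>\<phi>\<close>.  Comparing the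
  volume conditions of both immersions expresses \<open>\<lambda>\<^sup>5\<close> through the curve, so \<open>\<lambda>\<close> depends on \<open>t\<close> only.
  Differentiating \<open>\<nu>\<close> then forces the normal to have the form \<open>(\<alpha>(t), \<beta>(t) \<phi>)\<close>, whence \<open>S\<close> has
  \<open>\<partial>\<^sub>t\<close> as an eigenvector and is scalar on the tangent planes of \<open>N\<close>.  By Codazzi's equation
  \<open>h(K(X, Y), Z) = - (\<nabla>h)(X, Y, Z) / 2\<close> is a symmetric cubic form; it vanishes on \<open>(t, t, N)\<close>, is a
  multiple of \<open>h\<close> on \<open>(t, N, N)\<close>, and on \<open>N\<close> it is a multiple of the cubic form of \<open>\<phi>\<close>.  The latter is
  apolar because the metric of \<open>\<phi>\<close> induces the parallel volume, and a trace-free binary cubic form is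
  invariant under rotations by \<open>2\<pi>/3\<close>.  So \<open>Z\<^sub>3\<close> symmetry always holds.
\<close>

section \<open>Second derivatives\<close>

abbreviation dderiv :: "('a::real_normed_vector \<Rightarrow> 'b::real_normed_vector) \<Rightarrow> 'a \<Rightarrow> 'a \<Rightarrow> 'b"
  where "dderiv f p \<equiv> frechet_derivative f (at p)"

lemma smooth_on_differentiable:
  "smooth_on S f \<Longrightarrow> p \<in> S \<Longrightarrow> f differentiable (at p)"
  unfolding smooth_on_def by (metis differentiable_upto.simps(2))

lemma smooth_on_dderiv:
  "smooth_on S f \<Longrightarrow> smooth_on S (\<lambda>p. dderiv f p v)"
  unfolding smooth_on_def by (metis differentiable_upto.simps(2))

lemma dderiv_has_derivative:
  "f differentiable (at p) \<Longrightarrow> (f has_derivative dderiv f p) (at p)"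
  by (simp add: frechet_derivative_works)

lemma dderiv_eqI:
  "(f has_derivative f') (at p) \<Longrightarrow> dderiv f p = f'"
  by (metis frechet_derivative_at)

lemma linear_dderiv: "f differentiable (at p) \<Longrightarrow> linear (dderiv f p)"
  by (rule linear_frechet_derivative)

lemma dderiv_cong_open:
  assumes "open S" "p \<in> S" "\<And>q. q \<in> S \<Longrightarrow> f q = g q" "g differentiable (at p)"
  shows "dderiv f p = dderiv g p"
  by (metis assms frechet_derivative_transform_within_open)

lemma differentiable_cong_open:
  assumes "open S" "p \<in> S" "\<And>q. q \<in> S \<Longrightarrow> f q = g q" "g differentiable (at p)"
  shows "f differentiable (at p)"
  by (rule differentiableI[OF has_derivative_transform_within_open[OF dderiv_has_derivative[OF assms(4)] assms(1,2)]])
     (simp add: assms(3))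

lemma dderiv_inner_const:
  assumes "f differentiable (at p)"
  shows "dderiv (\<lambda>q. f q \<bullet> b) p v = dderiv f p v \<bullet> b"
  by (rule fun_cong[OF dderiv_eqI])
     (intro has_derivative_inner_left dderiv_has_derivative assms)

lemma differentiable_inner_left:
  "f differentiable (at p) \<Longrightarrow> (\<lambda>q. f q \<bullet> b) differentiable (at p)"
  unfolding differentiable_def by (blast intro: has_derivative_inner_left)

text \<open>The mean value theorem in direction \<open>v\<close> turns the second difference into
  \<open>s\<close> times an increment of the derivative along \<open>v\<close> over the step
  \<open>s *\<^sub>R w\<close>, and differentiability of that derivative at the single point
  \<open>p\<close> evaluates the increment up to o(s). The quotient is symmetric in \<open>v\<close>
  and \<open>w\<close> although its limit is not visibly so, which is what makes mixed derivatives
  commute.\<close>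

lemma second_difference_tendsto:
  fixes f :: "'a::euclidean_space \<Rightarrow> real"
  assumes S: "open S" "p \<in> S" and f: "\<And>q. q \<in> S \<Longrightarrow> f differentiable (at q)"
    and g: "(\<lambda>q. dderiv f q v) differentiable (at p)"
  shows "((\<lambda>s. (f (p + s *\<^sub>R v + s *\<^sub>R w) - f (p + s *\<^sub>R v) - f (p + s *\<^sub>R w) + f p) / s\<^sup>2)
           \<longlongrightarrow> dderiv (\<lambda>q. dderiv f q v) p w) (at_right 0)"
proof (rule tendstoI)
  fix e :: real assume e: "e > 0"
  define g where "g = (\<lambda>q. dderiv f q v)"
  define L where "L = dderiv g p"
  \<comment> \<open>\<open>s * M\<close> has to dominate the size of the parallelogram spanned by
    the two steps as well as the sum of the two remainders below, in which \<open>v\<close> occurs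
    twice; the summand 1 keeps \<open>M\<close> positive when both vectors vanish.\<close>
  define M where "M = 2 * norm v + norm w + 1"
  have M: "M > 0" unfolding M_def by (smt (verit) norm_ge_zero)
  have L: "(g has_derivative L) (at p)"
    using g unfolding g_def L_def by (rule dderiv_has_derivative)
  interpret L: linear L using L by (rule has_derivative_linear)
  have e': "e / (2 * M) > 0" using e M by simp
  obtain d where d: "d > 0" and dg: "\<And>y. norm (y - p) < d \<Longrightarrow>
      norm (g y - g p - L (y - p)) \<le> e / (2 * M) * norm (y - p)"
    using L[unfolded has_derivative_at_alt] e' by blast
  obtain r where r: "r > 0" "ball p r \<subseteq> S"
    using S by (meson openE)
  have "eventually (\<lambda>s::real. s < min r d / M) (at_right 0)"
    by (rule order_tendstoD[OF tendsto_ident_at]) (use r d M in auto)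
  moreover have "eventually (\<lambda>s::real. 0 < s) (at_right 0)"
    by (simp add: eventually_at_right_less)
  ultimately show "\<forall>\<^sub>F s in at_right 0.
      dist ((f (p + s *\<^sub>R v + s *\<^sub>R w) - f (p + s *\<^sub>R v) - f (p + s *\<^sub>R w) + f p) / s\<^sup>2)
        (dderiv (\<lambda>q. dderiv f q v) p w) < e"
  proof eventually_elim
    case (elim s)
    then have sM: "s * M < min r d" and s: "0 < s" using M by (auto simp: field_simps)
    have bnd: "norm (\<tau> *\<^sub>R v + c *\<^sub>R w) \<le> \<tau> * norm v + c * norm w" if "0 \<le> \<tau>" "0 \<le> c" for \<tau> c
      using norm_triangle_ineq[of "\<tau> *\<^sub>R v" "c *\<^sub>R w"] that by simp
    have bnd2: "\<tau> * norm v + c * norm w \<le> s * (norm v + norm w)"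
      if "0 \<le> \<tau>" "\<tau> \<le> s" "0 \<le> c" "c \<le> s" for \<tau> c
      using that mult_right_mono[of \<tau> s "norm v"] mult_right_mono[of c s "norm w"]
      by (simp add: algebra_simps)
    have bnd3: "s * (norm v + norm w) < min r d"
    proof -
      have "s * (norm v + norm w) \<le> s * M"
        using s by (intro mult_left_mono) (auto simp: M_def)
      then show ?thesis using sM by linarith
    qed
    have near: "norm (\<tau> *\<^sub>R v + c *\<^sub>R w) < min r d"
      if "0 \<le> \<tau>" "\<tau> \<le> s" "0 \<le> c" "c \<le> s" for \<tau> c
      using bnd[of \<tau> c] bnd2[of \<tau> c] bnd3 that by linarith
    have inS: "p + \<tau> *\<^sub>R v + c *\<^sub>R w \<in> S" if "0 \<le> \<tau>" "\<tau> \<le> s" "0 \<le> c" "c \<le> s" for \<tau> c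
      using near[OF that] r by (auto simp: subset_iff dist_norm norm_minus_commute add.assoc)
    have der: "((\<lambda>\<tau>. f (p + \<tau> *\<^sub>R v + c *\<^sub>R w)) has_real_derivative g (p + \<tau> *\<^sub>R v + c *\<^sub>R w)) (at \<tau>)"
      if "0 \<le> \<tau>" "\<tau> \<le> s" "0 \<le> c" "c \<le> s" for \<tau> c
    proof -
      have a: "((\<lambda>\<tau>. p + \<tau> *\<^sub>R v + c *\<^sub>R w) has_derivative (\<lambda>x. x *\<^sub>R v)) (at \<tau>)"
        by (auto intro!: derivative_eq_intros)
      have b: "(f has_derivative dderiv f (p + \<tau> *\<^sub>R v + c *\<^sub>R w)) (at (p + \<tau> *\<^sub>R v + c *\<^sub>R w))"
        by (intro dderiv_has_derivative f inS that)
      have l: "linear (dderiv f (p + \<tau> *\<^sub>R v + c *\<^sub>R w))"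
        by (intro linear_dderiv f inS that)
      have "dderiv f (p + \<tau> *\<^sub>R v + c *\<^sub>R w) \<circ> (\<lambda>x. x *\<^sub>R v) = times (g (p + \<tau> *\<^sub>R v + c *\<^sub>R w))"
        using linear_cmul[OF l, of _ v] by (simp add: fun_eq_iff g_def)
      with diff_chain_at[OF a b] show ?thesis
        by (simp add: o_def has_field_derivative_def)
    qed
    \<comment> \<open>The increment of \<open>f\<close> over the step \<open>s *\<^sub>R w\<close>,
      as a function of the position along \<open>v\<close>. The term \<open>0 *\<^sub>R w\<close>
      gives both summands the shape that \<open>der\<close> differentiates.\<close>
    define \<psi> where "\<psi> = (\<lambda>\<tau>. f (p + \<tau> *\<^sub>R v + s *\<^sub>R w) - f (p + \<tau> *\<^sub>R v + 0 *\<^sub>R w))"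
    have "\<exists>z>0. z < s \<and> \<psi> s - \<psi> 0
        = (s - 0) * (g (p + z *\<^sub>R v + s *\<^sub>R w) - g (p + z *\<^sub>R v + 0 *\<^sub>R w))"
      unfolding \<psi>_def using s by (intro MVT2[OF s] DERIV_diff der) simp_all
    then obtain z where z: "0 < z" "z < s" and \<psi>:
      "\<psi> s - \<psi> 0 = s * (g (p + z *\<^sub>R v + s *\<^sub>R w) - g (p + z *\<^sub>R v + 0 *\<^sub>R w))"
      by (metis diff_zero)
    have eq: "f (p + s *\<^sub>R v + s *\<^sub>R w) - f (p + s *\<^sub>R v) - f (p + s *\<^sub>R w) + f p
        = s * (g (p + z *\<^sub>R v + s *\<^sub>R w) - g (p + z *\<^sub>R v + 0 *\<^sub>R w))"
      unfolding \<psi>[symmetric] \<psi>_def by simp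
    let ?R = "\<lambda>c. g (p + z *\<^sub>R v + c *\<^sub>R w) - g p - L (z *\<^sub>R v + c *\<^sub>R w)"
    have R: "\<bar>?R c\<bar> \<le> e / (2 * M) * (z * norm v + c * norm w)" if c: "0 \<le> c" "c \<le> s" for c
    proof -
      have "norm (?R c) \<le> e / (2 * M) * norm (z *\<^sub>R v + c *\<^sub>R w)"
        using dg[of "p + (z *\<^sub>R v + c *\<^sub>R w)"] near[of z c] c z by (simp add: add.assoc)
      also have "\<dots> \<le> e / (2 * M) * (z * norm v + c * norm w)"
        using bnd[of z c] z c e' by (intro mult_left_mono) auto
      finally show ?thesis by simp
    qed
    \<comment> \<open>Both values of \<open>g\<close> are compared with the linearization at
      \<open>p\<close>; the contributions of \<open>z *\<^sub>R v\<close> cancel, so the unknown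
      \<open>z\<close> survives in the error term only.\<close>
    have "g (p + z *\<^sub>R v + s *\<^sub>R w) - g (p + z *\<^sub>R v + 0 *\<^sub>R w) - s * L w = ?R s - ?R 0"
      by (simp add: L.add L.scale)
    also have "\<bar>\<dots>\<bar> \<le> e / (2 * M) * (z * norm v + s * norm w) + e / (2 * M) * (z * norm v + 0 * norm w)"
      using R[of s] R[of 0] s by linarith
    also have "\<dots> = e / (2 * M) * (2 * (z * norm v) + s * norm w)"
      by (simp add: algebra_simps)
    also have "\<dots> \<le> e / (2 * M) * (s * M)"
      using z s e' mult_right_mono[of z s "norm v"]
      by (intro mult_left_mono) (auto simp: M_def algebra_simps)
    also have "\<dots> = e / 2 * s" using M by simp
    finally have main: "\<bar>g (p + z *\<^sub>R v + s *\<^sub>R w) - g (p + z *\<^sub>R v + 0 *\<^sub>R w) - s * L w\<bar> \<le> e / 2 * s" .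
    have "(s * (g (p + z *\<^sub>R v + s *\<^sub>R w) - g (p + z *\<^sub>R v + 0 *\<^sub>R w))) / s\<^sup>2 - L w
        = (g (p + z *\<^sub>R v + s *\<^sub>R w) - g (p + z *\<^sub>R v + 0 *\<^sub>R w) - s * L w) / s"
      using s by (simp add: field_simps power2_eq_square)
    also have "\<bar>\<dots>\<bar> \<le> e / 2" using main s by (simp add: abs_divide divide_le_eq)
    also have "\<dots> < e" using e by simp
    finally show ?case
      unfolding eq dist_real_def L_def g_def .
  qed
qed

text \<open>The second difference is symmetric in \<open>v\<close> and \<open>w\<close>, so the two
  limits agree by uniqueness.\<close>

lemma dderiv_commute_real:
  fixes f :: "'a::euclidean_space \<Rightarrow> real"
  assumes S: "open S" "p \<in> S" and f: "\<And>q. q \<in> S \<Longrightarrow> f differentiable (at q)"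
    and g: "\<And>v. (\<lambda>q. dderiv f q v) differentiable (at p)"
  shows "dderiv (\<lambda>q. dderiv f q v) p w = dderiv (\<lambda>q. dderiv f q w) p v"
proof -
  have "((\<lambda>s. (f (p + s *\<^sub>R v + s *\<^sub>R w) - f (p + s *\<^sub>R v) - f (p + s *\<^sub>R w) + f p) / s\<^sup>2)
           \<longlongrightarrow> dderiv (\<lambda>q. dderiv f q v) p w) (at_right 0)"
    using second_difference_tendsto[OF S f g, of v w] .
  moreover have "((\<lambda>s. (f (p + s *\<^sub>R v + s *\<^sub>R w) - f (p + s *\<^sub>R v) - f (p + s *\<^sub>R w) + f p) / s\<^sup>2)
           \<longlongrightarrow> dderiv (\<lambda>q. dderiv f q w) p v) (at_right 0)"
    using second_difference_tendsto[OF S f g, of w v] by (simp add: algebra_simps)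
  ultimately show ?thesis by (intro tendsto_unique) auto
qed

lemma dderiv_commute:
  fixes f :: "'a::euclidean_space \<Rightarrow> 'b::euclidean_space"
  assumes S: "open S" "p \<in> S" and f: "smooth_on S f"
  shows "dderiv (\<lambda>q. dderiv f q v) p w = dderiv (\<lambda>q. dderiv f q w) p v"
proof (rule euclidean_eqI)
  fix b :: 'b
  have c: "dderiv (\<lambda>q. f q \<bullet> b) q v = dderiv f q v \<bullet> b" if "q \<in> S" for q v
    by (intro dderiv_inner_const smooth_on_differentiable[OF f that])
  have d: "(\<lambda>q. dderiv f q v) differentiable (at p)" for v
    using smooth_on_dderiv[OF f] S(2) by (rule smooth_on_differentiable)
  have d': "(\<lambda>q. dderiv f q v \<bullet> b) differentiable (at p)" for v
    using d by (rule differentiable_inner_left)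
  have *: "dderiv (\<lambda>q. dderiv (\<lambda>q. f q \<bullet> b) q v) p w = dderiv (\<lambda>q. dderiv f q v) p w \<bullet> b" for v w
    by (simp add: dderiv_cong_open[OF S c d'] dderiv_inner_const d)
  have "dderiv (\<lambda>q. dderiv (\<lambda>q. f q \<bullet> b) q v) p w = dderiv (\<lambda>q. dderiv (\<lambda>q. f q \<bullet> b) q w) p v"
  proof (rule dderiv_commute_real[OF S])
    show "(\<lambda>q. f q \<bullet> b) differentiable at q" if "q \<in> S" for q
      using smooth_on_differentiable[OF f that] by (rule differentiable_inner_left)
    show "(\<lambda>q. dderiv (\<lambda>q. f q \<bullet> b) q v) differentiable at p" for v
      by (rule differentiable_cong_open[OF S _ d']) (rule c)
  qed
  then show "dderiv (\<lambda>q. dderiv f q v) p w \<bullet> b = dderiv (\<lambda>q. dderiv f q w) p v \<bullet> b"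
    by (simp add: *)
qed

section \<open>The cubic form of a hypersurface with equiaffine normal field\<close>

text \<open>By dimension: \<open>h z\<close> in coordinates depends injectively on \<open>z\<close>
  by nondegeneracy, hence surjectively. This supplies the vectors that the Koszul formula describes
  only through their products.\<close>

lemma bilinear_represent:
  fixes h :: "real^'m \<Rightarrow> real^'m \<Rightarrow> real"
  assumes h: "bilinear h" and nd: "\<And>v. (\<forall>w. h v w = 0) \<Longrightarrow> v = 0" and k: "linear k"
  shows "\<exists>z. \<forall>w. h z w = k w"
proof -
  define T where "T z = (\<chi> i. h z (axis i 1))" for z
  have eq: "h z w = k w" if "\<And>i. h z (axis i 1) = k (axis i 1)" "linear k" for z k w
  proof -
    have "h z = k"
      by (rule linear_eq_stdbasis)
         (use h that in \<open>auto simp: bilinear_def Basis_vec_def\<close>)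
    then show ?thesis by simp
  qed
  have "linear T"
    unfolding T_def by (rule linearI) (simp_all add: vec_eq_iff bilinear_ladd[OF h] bilinear_lmul[OF h])
  moreover have "inj T"
  proof (rule linear_injective_0[OF \<open>linear T\<close>, THEN iffD2, rule_format])
    fix z assume "T z = 0"
    then have "h z w = 0" for w
      using eq[of z "\<lambda>_. 0" w] by (simp add: T_def vec_eq_iff linear_0 module_hom_zero)
    then show "z = 0" using nd by blast
  qed
  ultimately have "surj T" by (rule linear_injective_imp_surjective) simp
  then obtain z where "T z = (\<chi> i. k (axis i 1))" by (metis surjD)
  then show ?thesis using eq[OF _ k] by (auto simp: T_def vec_eq_iff)
qed

text \<open>The fundamental lemma of pseudo-Riemannian geometry at one point. It shows that the
  definite description in \<open>christoffel\<close> has exactly one solution, which releases its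
  defining properties.\<close>

lemma christoffel_levi_civita:
  fixes h :: "real^'m \<Rightarrow> real^'m \<Rightarrow> real^'m \<Rightarrow> real"
  assumes S: "open S" "p \<in> S"
    and bil: "\<And>q. q \<in> S \<Longrightarrow> bilinear (h q)"
    and sym: "\<And>q v w. q \<in> S \<Longrightarrow> h q v w = h q w v"
    and diff: "\<And>v w. (\<lambda>q. h q v w) differentiable (at p)"
    and nd: "\<And>v. (\<forall>w. h p v w = 0) \<Longrightarrow> v = 0"
  shows "bilinear (christoffel h p)"
    and "christoffel h p u v = christoffel h p v u"
    and "dderiv (\<lambda>q. h q v w) p u = h p (christoffel h p u v) w + h p v (christoffel h p u w)"
proof -
  define d where "d u v w = dderiv (\<lambda>q. h q v w) p u" for u v w
  define P where "P G \<longleftrightarrow> bilinear G \<and> (\<forall>u v. G u v = G v u) \<and>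
     (\<forall>u v w. d u v w = h p (G u v) w + h p v (G u w))" for G
  note bl = bil[OF S(2)] and sy = sym[OF S(2)]
  note bs = bilinear_ladd[OF bl] bilinear_lmul[OF bl] bilinear_radd[OF bl] bilinear_rmul[OF bl]
  have d1: "linear (\<lambda>u. d u v w)" for v w
    unfolding d_def by (rule linear_dderiv[OF diff])
  have d_sym: "d u v w = d u w v" for u v w
    unfolding d_def by (rule fun_cong[OF dderiv_cong_open[OF S _ diff]]) (rule sym)
  have d3: "linear (d u v)" for u v
  proof (rule linearI)
    show "d u v (w + w') = d u v w + d u v w'" for w w'
    proof -
      have "dderiv (\<lambda>q. h q v (w + w')) p = dderiv (\<lambda>q. h q v w + h q v w') p"
        by (intro dderiv_cong_open[OF S] bilinear_radd bil differentiable_add diff)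
      also have "\<dots> = (\<lambda>u. d u v w + d u v w')"
        unfolding d_def by (intro dderiv_eqI has_derivative_add dderiv_has_derivative diff)
      finally show ?thesis by (simp add: d_def)
    qed
    show "d u v (c *\<^sub>R w) = c *\<^sub>R d u v w" for c w
    proof -
      have "dderiv (\<lambda>q. h q v (c *\<^sub>R w)) p = dderiv (\<lambda>q. c *\<^sub>R h q v w) p"
        by (intro dderiv_cong_open[OF S] bilinear_rmul[OF bil] differentiable_scaleR differentiable_const diff)
      also have "\<dots> = (\<lambda>u. c *\<^sub>R d u v w)"
        unfolding d_def by (intro dderiv_eqI has_derivative_scaleR_right dderiv_has_derivative diff)
      finally show ?thesis by (simp add: d_def)
    qed
  qed
  have d2: "linear (\<lambda>v. d u v w)" for u w
    using d3[of u w] by (simp add: d_sym[of u _ w])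
  have cancel: "x = y" if "\<And>w. h p x w = h p y w" for x y
    using nd[of "x - y"] that bilinear_lsub[OF bl] by simp
  \<comment> \<open>The Koszul formula; constant coordinate fields commute, so it has no bracket
    terms.\<close>
  define k where "k u v w = (d u v w + d v u w - d w u v) / 2" for u v w
  have k3: "linear (k u v)" for u v
    unfolding k_def
    by (rule linearI) (simp_all add: linear_add[OF d3] linear_add[OF d1] linear_cmul[OF d3] linear_cmul[OF d1] field_simps)
  have "\<exists>z. \<forall>w. h p z w = k u v w" for u v
    by (rule bilinear_represent[OF bl nd k3])
  then obtain G where G: "\<And>u v w. h p (G u v) w = k u v w" by metis
  have PG: "P G"
    unfolding P_def
  proof (intro conjI allI)
    have G_add: "G (u + u') v = G u v + G u' v" for u u' v
      by (rule cancel) (simp add: G bs k_def linear_add[OF d1] linear_add[OF d2] field_simps)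
    have G_mul: "G (c *\<^sub>R u) v = c *\<^sub>R G u v" for c u v
      by (rule cancel) (simp add: G bs k_def linear_cmul[OF d1] linear_cmul[OF d2] field_simps)
    show G_sym: "G u v = G v u" for u v
      by (rule cancel) (simp add: G k_def d_sym[of _ u v])
    have G_add_right: "G v (u + u') = G v u + G v u'" for u u' v
      by (metis G_sym G_add)
    have G_mul_right: "G v (c *\<^sub>R u) = c *\<^sub>R G v u" for c u v
      by (metis G_sym G_mul)
    show "bilinear G"
      unfolding bilinear_def
      by (intro conjI allI linearI) (simp_all add: G_add G_mul G_add_right G_mul_right)
    show "d u v w = h p (G u v) w + h p v (G u w)" for u v w
      unfolding sy[of v "G u w"] G using d_sym[of u w v] by (simp add: k_def field_simps)
  qed
  \<comment> \<open>Inserting the compatibility of \<open>G'\<close> into the three terms of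
    \<open>k\<close> cancels everything but \<open>2 * h p (G' u v) w\<close>.\<close>
  have uniq: "G' = G" if "P G'" for G'
  proof (intro ext cancel)
    fix u v w
    have c: "d u v w = h p (G' u v) w + h p v (G' u w)" for u v w
      using that by (simp add: P_def)
    have s: "G' u v = G' v u" for u v using that by (simp add: P_def)
    have "2 * k u v w = 2 * h p (G' u v) w"
      unfolding k_def c
      using s[of v u] s[of w u] s[of w v] sy[of v "G' u w"] sy[of u "G' v w"] sy[of u "G' w v"] by simp
    then show "h p (G' u v) w = h p (G u v) w" by (simp add: G)
  qed
  have "christoffel h p = (THE G. P G)"
    unfolding christoffel_def P_def d_def ..
  then have "P (christoffel h p)"
    using theI[of P, OF PG uniq] by simp
  then show "bilinear (christoffel h p)"
    and "christoffel h p u v = christoffel h p v u"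
    and "dderiv (\<lambda>q. h q v w) p u = h p (christoffel h p u v) w + h p v (christoffel h p u w)"
    by (auto simp: P_def d_def)
qed

text \<open>\<open>tangential\<close> and \<open>transversal\<close> arise from inverting the Gauss
  frame, a form that hides how they vary with the point. A differentiable covector field
  \<open>\<nu>\<close> dual to \<open>\<xi>\<close> turns the transversal component into an inner
  product that can be differentiated. The locale serves both the surface, with its position vector
  as transversal field, and the hypersurface.\<close>

locale conormal_field =
  fixes S :: "(real^'m) set" and f \<xi> \<nu> :: "real^'m \<Rightarrow> real^'n"
  assumes S: "open S"
    and f: "smooth_on S f"
    and bij: "\<And>p. p \<in> S \<Longrightarrow> bij (gauss_frame f \<xi> p)"
    and \<xi>: "\<And>p. p \<in> S \<Longrightarrow> \<xi> differentiable (at p)"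
    and \<nu>: "\<And>p. p \<in> S \<Longrightarrow> \<nu> differentiable (at p)"
    and \<nu>_tangent: "\<And>p v. p \<in> S \<Longrightarrow> \<nu> p \<bullet> dderiv f p v = 0"
    and \<nu>_\<xi>: "\<And>p. p \<in> S \<Longrightarrow> \<nu> p \<bullet> \<xi> p = 1"
    and equiaffine: "\<And>p v. p \<in> S \<Longrightarrow> transversal f \<xi> p (dderiv \<xi> p v) = 0"
begin

abbreviation "d2 p v w \<equiv> dderiv (\<lambda>q. dderiv f q w) p v"
abbreviation "h \<equiv> affine_metric f \<xi>"
abbreviation "\<Gamma> p v w \<equiv> tangential f \<xi> p (d2 p v w)"
abbreviation "K \<equiv> difference_tensor f \<xi>"

lemma gauss_frame_split:
  assumes "p \<in> S"
  shows "w = dderiv f p (tangential f \<xi> p w) + transversal f \<xi> p w *\<^sub>R \<xi> p"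
proof -
  have "gauss_frame f \<xi> p (inv (gauss_frame f \<xi> p) w) = w"
    by (rule surj_f_inv_f[OF bij_is_surj[OF bij[OF assms]]])
  then show ?thesis
    by (simp add: gauss_frame_def tangential_def transversal_def case_prod_beta)
qed

lemma tangential_eqI:
  assumes "p \<in> S" "w = dderiv f p v + c *\<^sub>R \<xi> p"
  shows "tangential f \<xi> p w = v"
proof -
  have "inv (gauss_frame f \<xi> p) w = (v, c)"
    by (rule inv_f_eq[OF bij_is_inj[OF bij[OF assms(1)]]]) (simp add: gauss_frame_def assms(2))
  then show ?thesis by (simp add: tangential_def)
qed

lemma transversal_eq:
  assumes "p \<in> S"
  shows "transversal f \<xi> p w = \<nu> p \<bullet> w"
proof -
  have "\<nu> p \<bullet> w = \<nu> p \<bullet> (dderiv f p (tangential f \<xi> p w) + transversal f \<xi> p w *\<^sub>R \<xi> p)"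
    using gauss_frame_split[OF assms] by metis
  then show ?thesis
    by (simp add: inner_add_right \<nu>_tangent[OF assms] \<nu>_\<xi>[OF assms])
qed

lemma affine_metric_eq:
  "p \<in> S \<Longrightarrow> h p v w = \<nu> p \<bullet> d2 p v w"
  by (simp add: affine_metric_def transversal_eq)

lemma smooth_dderiv: "smooth_on S (\<lambda>q. dderiv f q w)"
  by (rule smooth_on_dderiv[OF f])

lemma smooth_d2: "smooth_on S (\<lambda>q. d2 q v w)"
  by (rule smooth_on_dderiv[OF smooth_dderiv])

lemma d2_sym: "p \<in> S \<Longrightarrow> d2 p v w = d2 p w v"
  by (rule dderiv_commute[OF S _ f])

lemma bilinear_d2:
  assumes p: "p \<in> S"
  shows "bilinear (d2 p)"
proof -
  have "linear (\<lambda>v. d2 p v w)" for w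
    by (rule linear_dderiv[OF smooth_on_differentiable[OF smooth_dderiv p]])
  then show ?thesis
    unfolding bilinear_def using d2_sym[OF p] by simp
qed

lemma bilinear_affine_metric:
  assumes p: "p \<in> S"
  shows "bilinear (h p)"
  using bilinear_d2[OF p] unfolding bilinear_def linear_iff
  by (simp add: affine_metric_eq[OF p] inner_add_right)

lemma affine_metric_sym: "p \<in> S \<Longrightarrow> h p v w = h p w v"
  by (simp add: affine_metric_eq d2_sym[of p v w])

lemma differentiable_\<nu>_d2:
  assumes p: "p \<in> S"
  shows "(\<lambda>q. \<nu> q \<bullet> d2 q v w) differentiable (at p)"
  using has_derivative_inner[OF dderiv_has_derivative[OF \<nu>[OF p]]
      dderiv_has_derivative[OF smooth_on_differentiable[OF smooth_d2 p]]]
  by (rule differentiableI)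

lemma differentiable_affine_metric:
  assumes p: "p \<in> S"
  shows "(\<lambda>q. h q v w) differentiable (at p)"
  by (rule differentiable_cong_open[OF S p affine_metric_eq differentiable_\<nu>_d2[OF p]])

text \<open>The product rule applied to \<open>\<nu>_tangent\<close>; the term with the second
  derivative of \<open>f\<close> is the metric.\<close>

lemma dderiv_\<nu>_tangent:
  assumes p: "p \<in> S"
  shows "dderiv \<nu> p u \<bullet> dderiv f p v = - h p u v"
proof -
  have *: "((\<lambda>q. \<nu> q \<bullet> dderiv f q v) has_derivative
      (\<lambda>u. \<nu> p \<bullet> d2 p u v + dderiv \<nu> p u \<bullet> dderiv f p v)) (at p)"
    by (intro has_derivative_inner dderiv_has_derivative \<nu> p smooth_on_differentiable[OF smooth_dderiv p])
  have "dderiv (\<lambda>q. \<nu> q \<bullet> dderiv f q v) p = dderiv (\<lambda>_. 0) p"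
    by (rule dderiv_cong_open[OF S p]) (simp_all add: \<nu>_tangent)
  then have "\<nu> p \<bullet> d2 p u v + dderiv \<nu> p u \<bullet> dderiv f p v = 0"
    by (simp add: dderiv_eqI[OF *] fun_eq_iff)
  then show ?thesis
    by (simp add: affine_metric_eq[OF p])
qed

text \<open>The product rule applied to \<open>\<nu>_\<xi>\<close>, where equiaffinity removes the
  derivative of \<open>\<xi>\<close>.\<close>

lemma dderiv_\<nu>_\<xi>:
  assumes p: "p \<in> S"
  shows "dderiv \<nu> p u \<bullet> \<xi> p = 0"
proof -
  have *: "((\<lambda>q. \<nu> q \<bullet> \<xi> q) has_derivative
      (\<lambda>u. \<nu> p \<bullet> dderiv \<xi> p u + dderiv \<nu> p u \<bullet> \<xi> p)) (at p)"
    by (intro has_derivative_inner dderiv_has_derivative \<nu> \<xi> p)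
  have "dderiv (\<lambda>q. \<nu> q \<bullet> \<xi> q) p = dderiv (\<lambda>_. 1) p"
    by (rule dderiv_cong_open[OF S p]) (simp_all add: \<nu>_\<xi>)
  then have "\<nu> p \<bullet> dderiv \<xi> p u + dderiv \<nu> p u \<bullet> \<xi> p = 0"
    by (simp add: dderiv_eqI[OF *] fun_eq_iff)
  then show ?thesis
    using equiaffine[OF p, of u] by (simp add: transversal_eq[OF p])
qed

text \<open>The right side is a third derivative of \<open>f\<close> paired with
  \<open>\<nu>\<close>, hence symmetric in \<open>u\<close> and \<open>v\<close>; this is the source
  of Codazzi's equation. By the two preceding lemmas the derivative of \<open>\<nu>\<close> sees
  only the tangential part of \<open>d2 p v w\<close>.\<close>

lemma dderiv_affine_metric:
  assumes p: "p \<in> S"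
  shows "dderiv (\<lambda>q. h q v w) p u + h p u (\<Gamma> p v w) = \<nu> p \<bullet> dderiv (\<lambda>q. d2 q v w) p u"
proof -
  have "dderiv (\<lambda>q. h q v w) p = dderiv (\<lambda>q. \<nu> q \<bullet> d2 q v w) p"
    by (intro dderiv_cong_open[OF S p affine_metric_eq] differentiable_\<nu>_d2 p)
  also have "\<dots> = (\<lambda>u. \<nu> p \<bullet> dderiv (\<lambda>q. d2 q v w) p u + dderiv \<nu> p u \<bullet> d2 p v w)"
    by (intro dderiv_eqI has_derivative_inner dderiv_has_derivative \<nu> p smooth_on_differentiable[OF smooth_d2 p])
  finally have "dderiv (\<lambda>q. h q v w) p u
      = \<nu> p \<bullet> dderiv (\<lambda>q. d2 q v w) p u + dderiv \<nu> p u \<bullet> d2 p v w"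
    by simp
  moreover have "dderiv \<nu> p u \<bullet> d2 p v w = - h p u (\<Gamma> p v w)"
    by (subst gauss_frame_split[OF p, of "d2 p v w"])
       (simp add: inner_add_right dderiv_\<nu>_tangent[OF p] dderiv_\<nu>_\<xi>[OF p])
  ultimately show ?thesis by simp
qed

lemma \<Gamma>_sym: "p \<in> S \<Longrightarrow> \<Gamma> p v w = \<Gamma> p w v"
  by (simp add: d2_sym[of p v w])

lemma linear_tangential:
  assumes p: "p \<in> S"
  shows "linear (tangential f \<xi> p)"
proof -
  have l: "linear (dderiv f p)" by (rule linear_dderiv[OF smooth_on_differentiable[OF f p]])
  show ?thesis
  proof (rule linearI)
    fix v w c
    obtain a \<alpha> where v: "v = dderiv f p a + \<alpha> *\<^sub>R \<xi> p" using gauss_frame_split[OF p] by blast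
    obtain b \<beta> where w: "w = dderiv f p b + \<beta> *\<^sub>R \<xi> p" using gauss_frame_split[OF p] by blast
    have "tangential f \<xi> p (v + w) = a + b"
      by (rule tangential_eqI[OF p, where c = "\<alpha> + \<beta>"]) (simp add: v w linear_add[OF l] algebra_simps)
    then show "tangential f \<xi> p (v + w) = tangential f \<xi> p v + tangential f \<xi> p w"
      by (simp add: tangential_eqI[OF p v] tangential_eqI[OF p w])
    have "tangential f \<xi> p (c *\<^sub>R v) = c *\<^sub>R a"
      by (rule tangential_eqI[OF p, where c = "c * \<alpha>"]) (simp add: v linear_cmul[OF l] algebra_simps)
    then show "tangential f \<xi> p (c *\<^sub>R v) = c *\<^sub>R tangential f \<xi> p v"
      by (simp add: tangential_eqI[OF p v])
  qed
qed

lemma bilinear_\<Gamma>: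
  assumes p: "p \<in> S"
  shows "bilinear (\<Gamma> p)"
  using bilinear_d2[OF p] linear_tangential[OF p] unfolding bilinear_def linear_iff by simp

definition nabla_h where
  "nabla_h p u v w = dderiv (\<lambda>q. h q v w) p u - h p (\<Gamma> p u v) w - h p v (\<Gamma> p u w)"

text \<open>The cubic form is a third derivative of \<open>f\<close> paired with
  \<open>\<nu>\<close>, minus three connection terms whose sum is symmetric in all arguments. So the
  first symmetry is the commutation of derivatives, and the second is inherited from the symmetry of
  \<open>h\<close>.\<close>

lemma codazzi:
  assumes p: "p \<in> S"
  shows "nabla_h p u v w = nabla_h p v u w" and "nabla_h p u v w = nabla_h p u w v"
proof -
  define T where "T u v w = dderiv (\<lambda>q. h q v w) p u + h p u (\<Gamma> p v w)" for u v w
  have "T u v w = T v u w"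
  proof -
    have "dderiv (\<lambda>q. d2 q v w) p u = dderiv (\<lambda>q. d2 q u w) p v"
      by (rule dderiv_commute[OF S p smooth_dderiv])
    then show ?thesis unfolding T_def dderiv_affine_metric[OF p] by simp
  qed
  moreover have "nabla_h p u v w = T u v w - h p u (\<Gamma> p v w) - h p v (\<Gamma> p u w) - h p w (\<Gamma> p u v)" for u v w
    unfolding nabla_h_def T_def by (simp add: affine_metric_sym[OF p, of w])
  ultimately show "nabla_h p u v w = nabla_h p v u w"
    by (simp add: \<Gamma>_sym[OF p, of u v])
  have "dderiv (\<lambda>q. h q v w) p = dderiv (\<lambda>q. h q w v) p"
    by (rule dderiv_cong_open[OF S p affine_metric_sym differentiable_affine_metric[OF p]])
  then show "nabla_h p u v w = nabla_h p u w v"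
    unfolding nabla_h_def by (simp add: affine_metric_sym[OF p, of v] affine_metric_sym[OF p, of w])
qed

text \<open>\<open>K\<close> is the difference of two torsion-free connections, and the Levi-Civita
  one annihilates \<open>h\<close>, so \<open>nabla_h\<close> is expressed by \<open>K\<close>
  alone; total symmetry of \<open>nabla_h\<close> allows solving for \<open>K\<close>.\<close>

lemma difference_tensor:
  assumes p: "p \<in> S" and nd: "\<And>v. (\<forall>w. h p v w = 0) \<Longrightarrow> v = 0"
  shows "bilinear (K p)" and "K p u v = K p v u"
    and "h p (K p u v) w = - nabla_h p u v w / 2"
proof -
  let ?C = "christoffel h p"
  note chr = christoffel_levi_civita[of S p h, OF S p bilinear_affine_metric affine_metric_sym
      differentiable_affine_metric[OF p] nd]
  have K: "K p u v = \<Gamma> p u v - ?C u v" for u v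
    by (simp add: difference_tensor_def induced_connection_def levi_civita_def)
  note bl = bilinear_affine_metric[OF p]
  have K_sym: "K p u v = K p v u" for u v
    unfolding K using \<Gamma>_sym[OF p] chr(2) by simp
  show "K p u v = K p v u" by (rule K_sym)
  show "bilinear (K p)"
    using bilinear_\<Gamma>[OF p] chr(1) unfolding bilinear_def linear_iff K
    by (simp add: algebra_simps)
  have e: "- nabla_h p u v w = h p (K p u v) w + h p (K p u w) v" for u v w
    unfolding nabla_h_def K using chr(3)[of v w u]
    by (simp add: bilinear_lsub[OF bl] affine_metric_sym[OF p, of v])
  have "nabla_h p v u w = nabla_h p u v w" "nabla_h p w u v = nabla_h p u v w"
    using codazzi(1)[OF p, of v u w] codazzi(2)[OF p, of u v w] codazzi(1)[OF p, of w u v] by simp_all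
  \<comment> \<open>Adding the first two instances of \<open>e\<close> and subtracting the third
    leaves \<open>2 * h p (K p u v) w\<close>, as in the Koszul formula.\<close>
  then show "h p (K p u v) w = - nabla_h p u v w / 2"
    using e[of u v w] e[of v u w] e[of w u v] K_sym[of u w] K_sym[of v w] K_sym[of u v] by simp
qed

end

section \<open>Rotations and symmetric cubic forms\<close>

text \<open>Laplace expansion along the first two rows; \<open>m i j\<close> is the minor of the
  last two rows in the columns \<open>i\<close> and \<open>j\<close>.\<close>

lemma det_4:
  "det (A::real^4^4) =
    (let m = (\<lambda>i j. A$3$i * A$4$j - A$3$j * A$4$i) in
      (A$1$1 * A$2$2 - A$1$2 * A$2$1) * m 3 4 - (A$1$1 * A$2$3 - A$1$3 * A$2$1) * m 2 4
    + (A$1$1 * A$2$4 - A$1$4 * A$2$1) * m 2 3 + (A$1$2 * A$2$3 - A$1$3 * A$2$2) * m 1 4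
    - (A$1$2 * A$2$4 - A$1$4 * A$2$2) * m 1 3 + (A$1$3 * A$2$4 - A$1$4 * A$2$3) * m 1 2)"
proof -
  have f1234: "finite {2::4, 3, 4}" "1 \<notin> {2::4, 3, 4}"
    and f234: "finite {3::4, 4}" "2 \<notin> {3::4, 4}"
    and f34: "finite {4::4}" "3 \<notin> {4::4}"
    by auto
  show ?thesis
    unfolding det_def UNIV_4
    unfolding sum_over_permutations_insert[OF f1234]
    unfolding sum_over_permutations_insert[OF f234]
    unfolding sum_over_permutations_insert[OF f34]
    unfolding permutes_sing
    by (simp add: sign_swap_id permutation_swap_id sign_compose permutation_compose sign_id swap_id_eq Let_def)
       (simp add: algebra_simps)
qed

locale orthonormal_frame =
  fixes h :: "real^3 \<Rightarrow> real^3 \<Rightarrow> real" and e :: "3 \<Rightarrow> real^3"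
  assumes h: "bilinear h" and h_sym: "h v w = h w v"
    and e: "h (e i) (e j) = (if i = j then 1 else 0)"
begin

lemmas h_simps = bilinear_ladd[OF h] bilinear_lmul[OF h] bilinear_radd[OF h] bilinear_rmul[OF h]
  bilinear_lneg[OF h] bilinear_rneg[OF h] bilinear_lsub[OF h] bilinear_rsub[OF h]

lemma expansion: "v = h v (e 1) *\<^sub>R e 1 + h v (e 2) *\<^sub>R e 2 + h v (e 3) *\<^sub>R e 3"
proof -
  define T where "T a = a$1 *\<^sub>R e 1 + a$2 *\<^sub>R e 2 + a$3 *\<^sub>R e 3" for a :: "real^3"
  have hT: "h (T a) (e j) = a$j" for a j
    using exhaust_3[of j] by (auto simp: T_def h_simps e)
  have "linear T"
    unfolding T_def by (rule linearI) (simp_all add: algebra_simps)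
  moreover have "inj T"
    by (rule injI) (metis hT vec_eq_iff)
  ultimately have "surj T" by (rule linear_injective_imp_surjective) simp
  then obtain a where "v = T a" by (metis surjD)
  then show ?thesis by (metis T_def hT)
qed

lemma frame_eqI:
  assumes "h v (e 1) = h w (e 1)" "h v (e 2) = h w (e 2)" "h v (e 3) = h w (e 3)"
  shows "v = w"
  by (metis assms expansion)

abbreviation rot where "rot \<equiv> rotation_about h e"

lemma h_rot:
  "h (rot \<theta> v) (e 1) = h v (e 1)"
  "h (rot \<theta> v) (e 2) = cos \<theta> * h v (e 2) - sin \<theta> * h v (e 3)"
  "h (rot \<theta> v) (e 3) = sin \<theta> * h v (e 2) + cos \<theta> * h v (e 3)"
  by (simp_all add: rotation_about_def h_simps e)

lemma linear_rot: "linear (rot \<theta>)"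
  by (rule linearI; rule frame_eqI) (simp_all add: h_rot h_simps algebra_simps)

lemma parseval:
  "h v w = h v (e 1) * h w (e 1) + h v (e 2) * h w (e 2) + h v (e 3) * h w (e 3)"
  by (subst expansion[of v]) (simp add: h_simps h_sym[of "e _" w])

lemma rot_isometry: "h (rot \<theta> v) (rot \<theta> w) = h v w"
proof -
  have "sin \<theta> * sin \<theta> + cos \<theta> * cos \<theta> = 1"
    using sin_cos_squared_add[of \<theta>] by (simp add: power2_eq_square)
  then show ?thesis
    unfolding parseval[of "rot \<theta> v" "rot \<theta> w"] parseval[of v w] h_rot
    by algebra
qed

lemma rot_rot: "rot \<theta> (rot \<theta>' v) = rot (\<theta> + \<theta>') v"
  by (rule frame_eqI) (simp_all add: h_rot cos_add sin_add algebra_simps)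

lemma rot_0: "rot 0 v = v"
  by (rule frame_eqI) (simp_all add: h_rot)

text \<open>A rotation is the square of the rotation by half the angle, hence has positive determinant.\<close>

lemma rot_special: "rot \<theta> \<in> special_isometries h"
proof -
  have comp: "det (matrix (rot (\<alpha> + \<beta>))) = det (matrix (rot \<alpha>)) * det (matrix (rot \<beta>))" for \<alpha> \<beta>
  proof -
    have "rot (\<alpha> + \<beta>) = rot \<alpha> \<circ> rot \<beta>" by (simp add: fun_eq_iff rot_rot)
    then show ?thesis using matrix_compose[OF linear_rot linear_rot, of \<alpha> \<beta>] by (simp add: det_mul)
  qed
  have "rot 0 = id" by (simp add: fun_eq_iff rot_0)
  then have "det (matrix (rot 0)) = 1" by simp
  then have "det (matrix (rot \<theta>)) \<noteq> 0"
    using comp[of \<theta> "- \<theta>"] by auto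
  moreover have "det (matrix (rot \<theta>)) = det (matrix (rot (\<theta>/2))) * det (matrix (rot (\<theta>/2)))"
    using comp[of "\<theta>/2" "\<theta>/2"] by simp
  ultimately have "det (matrix (rot \<theta>)) > 0"
    by (metis mult_eq_0_iff not_real_square_gt_zero)
  then show ?thesis
    by (simp add: special_isometries_def linear_rot rot_isometry)
qed

lemma rot_frame:
  "rot \<theta> (e 1) = e 1"
  "rot \<theta> (e 2) = cos \<theta> *\<^sub>R e 2 + sin \<theta> *\<^sub>R e 3"
  "rot \<theta> (e 3) = - sin \<theta> *\<^sub>R e 2 + cos \<theta> *\<^sub>R e 3"
  by (simp_all add: rotation_about_def e)

text \<open>
  The cubic form of \<open>K\<close> splits into a rotationally symmetric part and a trace-free binary cubic form
  in the last two directions, i.e. the real part of \<open>c z\<^sup>3\<close> for a complex coordinate \<open>z\<close>.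
\<close>

lemma rot_commutes_K:
  assumes K: "bilinear K" and K_sym: "\<And>v w. K v w = K w v"
    and C: "\<And>u v w. h (K u v) w = h (K u w) v"
    and zero: "h (K (e 1) (e 1)) (e 2) = 0" "h (K (e 1) (e 1)) (e 3) = 0" "h (K (e 1) (e 2)) (e 3) = 0"
    and umbilic: "h (K (e 1) (e 2)) (e 2) = h (K (e 1) (e 3)) (e 3)"
    and apolar: "h (K (e 2) (e 2)) (e 2) + h (K (e 2) (e 3)) (e 3) = 0"
      "h (K (e 3) (e 2)) (e 2) + h (K (e 3) (e 3)) (e 3) = 0"
    and \<theta>: "cos (2 * \<theta>) = cos \<theta>" "sin (2 * \<theta>) = - sin \<theta>"
  shows "K (rot \<theta> v) (rot \<theta> w) = rot \<theta> (K v w)"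
proof -
  define c s where "c = cos \<theta>" and "s = sin \<theta>"
  \<comment> \<open>The hypotheses on \<open>\<theta>\<close> say exp(2i\<theta>) = exp(-i\<theta>),
    that is, 3\<theta> is a multiple of 2 pi. Here they become polynomial identities in
    \<open>c\<close> and \<open>s\<close>.\<close>
  have cs: "c * c - s * s = c" "2 * (s * c) = - s" "s * s + c * c = 1"
    using \<theta> sin_cos_squared_add[of \<theta>] by (simp_all add: c_def s_def cos_double sin_double power2_eq_square)
  note K_simps = bilinear_ladd[OF K] bilinear_lmul[OF K] bilinear_radd[OF K] bilinear_rmul[OF K]
    bilinear_lneg[OF K] bilinear_rneg[OF K] bilinear_lsub[OF K] bilinear_rsub[OF K]
  define k \<kappa> \<alpha> \<beta> where "k = h (K (e 1) (e 1)) (e 1)" and "\<kappa> = h (K (e 1) (e 2)) (e 2)" and "\<alpha> = h (K (e 2) (e 2)) (e 2)"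
    and "\<beta> = h (K (e 2) (e 2)) (e 3)"
  \<comment> \<open>The multiplication table of \<open>K\<close>: \<open>k\<close> and
    \<open>\<kappa>\<close> carry the rotationally symmetric part, \<open>\<alpha>\<close> and
    \<open>\<beta>\<close> are the two parameters of a trace-free binary cubic form.\<close>
  have K_frame:
    "K (e 1) (e 1) = k *\<^sub>R e 1"
    "K (e 1) (e 2) = \<kappa> *\<^sub>R e 2" "K (e 2) (e 1) = \<kappa> *\<^sub>R e 2"
    "K (e 1) (e 3) = \<kappa> *\<^sub>R e 3" "K (e 3) (e 1) = \<kappa> *\<^sub>R e 3"
    "K (e 2) (e 2) = \<kappa> *\<^sub>R e 1 + \<alpha> *\<^sub>R e 2 + \<beta> *\<^sub>R e 3"
    "K (e 2) (e 3) = \<beta> *\<^sub>R e 2 - \<alpha> *\<^sub>R e 3" "K (e 3) (e 2) = \<beta> *\<^sub>R e 2 - \<alpha> *\<^sub>R e 3"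
    "K (e 3) (e 3) = \<kappa> *\<^sub>R e 1 - \<alpha> *\<^sub>R e 2 - \<beta> *\<^sub>R e 3"
    using zero umbilic apolar C[of "e 1" "e 2" "e 3"] C[of "e 1" "e 1" "e 2"] C[of "e 1" "e 1" "e 3"]
      C[of "e 2" "e 1" "e 2"] C[of "e 2" "e 1" "e 3"] C[of "e 2" "e 2" "e 3"] C[of "e 3" "e 1" "e 2"]
      C[of "e 3" "e 1" "e 3"] C[of "e 3" "e 2" "e 3"]
      K_sym[of "e 2" "e 1"] K_sym[of "e 3" "e 1"] K_sym[of "e 3" "e 2"]
    by - (rule frame_eqI; simp add: h_simps e k_def \<kappa>_def \<alpha>_def \<beta>_def)+
  interpret R: linear "rot \<theta>" by (rule linear_rot)
  note R_simps = R.add R.scale R.diff rot_frame[of \<theta>, folded c_def s_def]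
  define F where "F u v \<longleftrightarrow> K (rot \<theta> u) (rot \<theta> v) = rot \<theta> (K u v)" for u v
  have F_sym: "F u v \<longleftrightarrow> F v u" for u v unfolding F_def by (simp add: K_sym)
  have F_lin: "F u (a *\<^sub>R e 1 + b *\<^sub>R e 2 + d *\<^sub>R e 3)" if "F u (e 1)" "F u (e 2)" "F u (e 3)" for u a b d
    using that unfolding F_def by (simp add: K_simps R.add R.scale)
  have "F (e 1) (e 1)" unfolding F_def by (simp add: R_simps K_frame)
  moreover have "F (e 1) (e 2)" "F (e 1) (e 3)"
    unfolding F_def by (simp_all add: R_simps K_frame K_simps algebra_simps)
  moreover have "F (e 2) (e 2)"
  proof -
    \<comment> \<open>Grouping the coefficients by double angles lets \<open>cs\<close> rewrite them
      to those of the rotated value.\<close>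
    have "K (rot \<theta> (e 2)) (rot \<theta> (e 2)) = ((s * s + c * c) * \<kappa>) *\<^sub>R e 1
        + ((c * c - s * s) * \<alpha> + (2 * (s * c)) * \<beta>) *\<^sub>R e 2
        + ((c * c - s * s) * \<beta> - (2 * (s * c)) * \<alpha>) *\<^sub>R e 3"
      by (simp add: R_simps K_simps K_frame) (rule frame_eqI; simp add: h_simps e; simp add: algebra_simps)
    then show ?thesis
      unfolding F_def cs by (simp add: R_simps K_frame algebra_simps)
  qed
  moreover have "F (e 2) (e 3)"
  proof -
    have "K (rot \<theta> (e 2)) (rot \<theta> (e 3)) =
        ((c * c - s * s) * \<beta> - (2 * (s * c)) * \<alpha>) *\<^sub>R e 2
        - ((c * c - s * s) * \<alpha> + (2 * (s * c)) * \<beta>) *\<^sub>R e 3"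
      by (simp add: R_simps K_simps K_frame) (rule frame_eqI; simp add: h_simps e; simp add: algebra_simps)
    then show ?thesis
      unfolding F_def cs by (simp add: R_simps K_frame algebra_simps)
  qed
  moreover have "F (e 3) (e 3)"
  proof -
    have "K (rot \<theta> (e 3)) (rot \<theta> (e 3)) = ((s * s + c * c) * \<kappa>) *\<^sub>R e 1
        - ((c * c - s * s) * \<alpha> + (2 * (s * c)) * \<beta>) *\<^sub>R e 2
        - ((c * c - s * s) * \<beta> - (2 * (s * c)) * \<alpha>) *\<^sub>R e 3"
      by (simp add: R_simps K_simps K_frame) (rule frame_eqI; simp add: h_simps e; simp add: algebra_simps)
    then show ?thesis
      unfolding F_def cs by (simp add: R_simps K_frame algebra_simps)
  qed
  ultimately have "F (e i) (e j)" for i j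
    using F_sym exhaust_3[of i] exhaust_3[of j] by metis
  then have "F (e i) v" for i v
    by (subst expansion[of v]) (intro F_lin)
  then have "F v (e i)" for i v
    using F_sym by blast
  then have "F v w"
    by (subst expansion[of w]) (intro F_lin)
  then show ?thesis by (simp add: F_def)
qed

lemma rot_commutes_S:
  assumes S: "linear S" "S (e 1) = a *\<^sub>R e 1" "S (e 2) = b *\<^sub>R e 2" "S (e 3) = b *\<^sub>R e 3"
  shows "S (rot \<theta> v) = rot \<theta> (S v)"
proof -
  interpret S: linear S by fact
  interpret R: linear "rot \<theta>" by (rule linear_rot)
  show ?thesis
    by (subst (1 2) expansion[of v]) (simp add: R.add R.scale rot_frame S.add S.scale S.diff S.neg assms(2-4) algebra_simps)
qed

end

text \<open>Besides an orthonormal basis this records how it is used later: its squared area is the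
  inverse Gram determinant, which serves the volume conditions, and the trace of a symmetric form in
  it is an expression in the coordinate entries, which serves apolarity.\<close>

lemma gram_schmidt_2:
  fixes b :: "real^2 \<Rightarrow> real^2 \<Rightarrow> real"
  assumes b: "bilinear b" and sym: "\<And>v w. b v w = b w v" and pos: "\<forall>v. v \<noteq> 0 \<longrightarrow> b v v > 0"
  defines "\<Delta> \<equiv> b (axis 1 1) (axis 1 1) * b (axis 2 1) (axis 2 1) - (b (axis 1 1) (axis 2 1))\<^sup>2"
  shows "\<exists>X Y. b X X = 1 \<and> b Y Y = 1 \<and> b X Y = 0 \<and> (X$1 * Y$2 - X$2 * Y$1)\<^sup>2 * \<Delta> = 1 \<and>
    (\<forall>P. bilinear P \<and> (\<forall>v w. P v w = P w v) \<longrightarrow>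
      (P X X + P Y Y) * \<Delta> = b (axis 2 1) (axis 2 1) * P (axis 1 1) (axis 1 1)
        - 2 * b (axis 1 1) (axis 2 1) * P (axis 1 1) (axis 2 1) + b (axis 1 1) (axis 1 1) * P (axis 2 1) (axis 2 1))"
proof -
  define e1 e2 :: "real^2" where "e1 = axis 1 1" and "e2 = axis 2 1"
  define E F G where "E = b e1 e1" and "F = b e1 e2" and "G = b e2 e2"
  note b_simps = bilinear_ladd[OF b] bilinear_lmul[OF b] bilinear_radd[OF b] bilinear_rmul[OF b]
    bilinear_lsub[OF b] bilinear_rsub[OF b]
  have \<Delta>: "\<Delta> = E * G - F\<^sup>2" by (simp add: \<Delta>_def E_def F_def G_def e1_def e2_def)
  have E: "E > 0" unfolding E_def by (rule pos[rule_format]) (simp add: e1_def axis_eq_0_iff)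
  \<comment> \<open>The Gram-Schmidt vector cleared of its denominator; its square
    \<open>E * \<Delta>\<close> also yields the positivity of \<open>\<Delta>\<close>.\<close>
  define Y0 where "Y0 = E *\<^sub>R e2 - F *\<^sub>R e1"
  have "Y0 $ 2 \<noteq> 0" using E by (simp add: Y0_def e1_def e2_def axis_def)
  then have "b Y0 Y0 > 0" by (intro pos[rule_format]) auto
  also have "b Y0 Y0 = E * \<Delta>"
    by (simp add: Y0_def b_simps \<Delta> sym[of e2 e1] flip: E_def F_def G_def) (simp add: algebra_simps power2_eq_square)
  finally have D: "\<Delta> > 0" using E by (simp add: zero_less_mult_iff)
  define s t where "s = 1 / sqrt E" and "t = 1 / sqrt (E * \<Delta>)"
  have s: "s * s * E = 1" and t: "t * t * (E * \<Delta>) = 1"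
    using E D by (simp_all add: s_def t_def field_simps real_sqrt_mult)
  define X Y where "X = s *\<^sub>R e1" and "Y = t *\<^sub>R Y0"
  show ?thesis
  proof (intro exI conjI allI impI)
    show "b X X = 1" using s by (simp add: X_def b_simps flip: E_def)
    show "b Y Y = 1" using t \<open>b Y0 Y0 = E * \<Delta>\<close> by (simp add: Y_def b_simps)
    show "b X Y = 0" by (simp add: X_def Y_def Y0_def b_simps flip: E_def F_def)
    have "X$1 * Y$2 - X$2 * Y$1 = s * t * E" by (simp add: X_def Y_def Y0_def e1_def e2_def axis_def)
    then have "(X$1 * Y$2 - X$2 * Y$1)\<^sup>2 * \<Delta> = (s * s * E) * (t * t * (E * \<Delta>))"
      by (simp add: power2_eq_square algebra_simps)
    then show "(X$1 * Y$2 - X$2 * Y$1)\<^sup>2 * \<Delta> = 1" unfolding s t by simp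
    fix P :: "real^2 \<Rightarrow> real^2 \<Rightarrow> real"
    assume "bilinear P \<and> (\<forall>v w. P v w = P w v)"
    then have P: "bilinear P" and P_sym: "P v w = P w v" for v w by auto
    note P_simps = bilinear_ladd[OF P] bilinear_lmul[OF P] bilinear_radd[OF P] bilinear_rmul[OF P]
      bilinear_lsub[OF P] bilinear_rsub[OF P]
    have "P X X = s * s * P e1 e1" by (simp add: X_def P_simps)
    moreover have "P Y Y = t * t * (E * E * P e2 e2 - 2 * E * F * P e1 e2 + F * F * P e1 e1)"
      by (simp add: Y_def Y0_def P_simps P_sym[of e2 e1]) (simp add: algebra_simps)
    \<comment> \<open>After multiplication by \<open>E\<close> the square roots occur only in the
      combinations that \<open>s\<close> and \<open>t\<close> evaluate to 1.\<close>
    moreover have "E * ((s * s * p1 + t * t * (E * E * p2 - 2 * E * F * p + F * F * p1)) * \<Delta>)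
        = E * (G * p1 - 2 * F * p + E * p2)" for p1 p p2
    proof -
      have "E * ((s * s * p1 + t * t * (E * E * p2 - 2 * E * F * p + F * F * p1)) * \<Delta>)
        = (s * s * E) * \<Delta> * p1 + t * t * (E * \<Delta>) * (E * E * p2 - 2 * E * F * p + F * F * p1)"
        by (simp add: algebra_simps)
      also have "\<dots> = \<Delta> * p1 + (E * E * p2 - 2 * E * F * p + F * F * p1)"
        unfolding s t by simp
      finally show ?thesis unfolding \<Delta> by (simp add: algebra_simps power2_eq_square)
    qed
    ultimately have "(P X X + P Y Y) * \<Delta> = G * P e1 e1 - 2 * F * P e1 e2 + E * P e2 e2"
      using E by simp
    then show "(P X X + P Y Y) * \<Delta> = b (axis 2 1) (axis 2 1) * P (axis 1 1) (axis 1 1)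
        - 2 * b (axis 1 1) (axis 2 1) * P (axis 1 1) (axis 2 1) + b (axis 1 1) (axis 1 1) * P (axis 2 1) (axis 2 1)"
      by (simp add: E_def F_def G_def e1_def e2_def)
  qed
qed

section \<open>Centroaffine surfaces\<close>

unbundle cross3_syntax

lemma real2_expansion: "v = v$1 *\<^sub>R axis 1 1 + v$2 *\<^sub>R axis 2 1" for v :: "real^2"
  by (simp add: vec_eq_iff forall_2 axis_def)

lemma has_derivative_cross3:
  assumes "(f has_derivative f') (at p)" "(g has_derivative g') (at p)"
  shows "((\<lambda>q. f q \<times> g q) has_derivative (\<lambda>v. f p \<times> g' v + f' v \<times> g p)) (at p)"
proof -
  interpret bounded_bilinear "(\<times>)"
    using bilinear_cross by (simp add: bilinear_conv_bounded_bilinear)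
  show ?thesis using FDERIV[OF assms] .
qed

text \<open>The affine normal of a proper affine sphere is a constant multiple of the position
  vector, so the position vector itself is taken as transversal field; the metric changes only by a
  constant factor.\<close>

locale centroaffine_surface =
  fixes V :: "(real^2) set" and \<Phi> :: "real^2 \<Rightarrow> real^3"
  assumes V: "open V" and \<Phi>: "smooth_on V \<Phi>"
    and frame: "\<And>q. q \<in> V \<Longrightarrow> bij (gauss_frame \<Phi> \<Phi> q)"
begin

definition \<Phi>1 where "\<Phi>1 q = dderiv \<Phi> q (axis 1 1)"
definition \<Phi>2 where "\<Phi>2 q = dderiv \<Phi> q (axis 2 1)"
definition vol where "vol q = \<Phi> q \<bullet> (\<Phi>1 q \<times> \<Phi>2 q)"
definition conormal where "conormal q = (1 / vol q) *\<^sub>R (\<Phi>1 q \<times> \<Phi>2 q)"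

lemma linear_d\<Phi>: "q \<in> V \<Longrightarrow> linear (dderiv \<Phi> q)"
  by (rule linear_dderiv[OF smooth_on_differentiable[OF \<Phi>]])

lemma d\<Phi>_expansion:
  assumes q: "q \<in> V"
  shows "dderiv \<Phi> q X = X$1 *\<^sub>R \<Phi>1 q + X$2 *\<^sub>R \<Phi>2 q"
proof -
  interpret linear "dderiv \<Phi> q" by (rule linear_d\<Phi>[OF q])
  show ?thesis by (subst real2_expansion[of X]) (simp only: add scale \<Phi>1_def \<Phi>2_def)
qed

lemma cross_d\<Phi>:
  assumes q: "q \<in> V"
  shows "dderiv \<Phi> q X \<times> dderiv \<Phi> q Y = (X$1 * Y$2 - X$2 * Y$1) *\<^sub>R (\<Phi>1 q \<times> \<Phi>2 q)"
  unfolding d\<Phi>_expansion[OF q]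
  by (simp add: cross_add_left cross_add_right cross_mult_left cross_mult_right cross_skew[of "\<Phi>2 q" "\<Phi>1 q"]
      scaleR_left_diff_distrib mult.commute)

lemma gauss_frame_eq_0:
  assumes q: "q \<in> V" and "dderiv \<Phi> q X + c *\<^sub>R \<Phi> q = 0"
  shows "X = 0 \<and> c = 0"
proof -
  have "gauss_frame \<Phi> \<Phi> q (X, c) = gauss_frame \<Phi> \<Phi> q (0, 0)"
    using assms(2) by (simp add: gauss_frame_def linear_0[OF linear_d\<Phi>[OF q]])
  then show ?thesis using bij_is_inj[OF frame[OF q]] by (auto dest: injD)
qed

text \<open>Otherwise the cross product of the tangent vectors would be orthogonal to the image of
  the Gauss frame, which is the whole space. The tangent vectors would then be dependent, against
  injectivity of the frame.\<close>

lemma vol_nonzero: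
  assumes q: "q \<in> V"
  shows "vol q \<noteq> 0"
proof
  assume 0: "vol q = 0"
  have "(\<Phi>1 q \<times> \<Phi>2 q) \<bullet> w = 0" for w
  proof -
    obtain X c where "w = gauss_frame \<Phi> \<Phi> q (X, c)"
      using bij_is_surj[OF frame[OF q]] by (metis surjD surj_pair)
    then have "w = X$1 *\<^sub>R \<Phi>1 q + X$2 *\<^sub>R \<Phi>2 q + c *\<^sub>R \<Phi> q"
      by (simp add: gauss_frame_def d\<Phi>_expansion[OF q])
    then show ?thesis
      using 0 by (simp add: inner_add_right dot_cross_self vol_def inner_commute)
  qed
  then have "\<Phi>1 q \<times> \<Phi>2 q = 0" by (metis inner_eq_zero_iff)
  then have "collinear {0, \<Phi>1 q, \<Phi>2 q}" by (simp add: cross_eq_0)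
  then consider "\<Phi>1 q = 0" | "\<Phi>2 q = 0" | c where "\<Phi>2 q = c *\<^sub>R \<Phi>1 q"
    by (auto simp: collinear_lemma)
  then show False
  proof cases
    case 1
    then show ?thesis using gauss_frame_eq_0[OF q, of "axis 1 1" 0] by (simp add: \<Phi>1_def axis_eq_0_iff)
  next
    case 2
    then show ?thesis using gauss_frame_eq_0[OF q, of "axis 2 1" 0] by (simp add: \<Phi>2_def axis_eq_0_iff)
  next
    case (3 c)
    let ?X = "axis 2 1 - c *\<^sub>R axis 1 1 :: real^2"
    have "dderiv \<Phi> q ?X + 0 *\<^sub>R \<Phi> q = 0"
      using 3 by (simp add: d\<Phi>_expansion[OF q] axis_def)
    then have "?X = 0" using gauss_frame_eq_0[OF q] by blast
    then have "?X $ 2 = 0" by simp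
    then show ?thesis by (simp add: axis_def)
  qed
qed

lemma conormal_\<Phi>: "q \<in> V \<Longrightarrow> conormal q \<bullet> \<Phi> q = 1"
  using vol_nonzero[of q] by (simp add: conormal_def vol_def inner_commute)

lemma conormal_d\<Phi>: "q \<in> V \<Longrightarrow> conormal q \<bullet> dderiv \<Phi> q X = 0"
  by (simp add: d\<Phi>_expansion conormal_def inner_add_right dot_cross_self)

lemma smooth_\<Phi>12: "smooth_on V \<Phi>1" "smooth_on V \<Phi>2"
  unfolding \<Phi>1_def[abs_def] \<Phi>2_def[abs_def] by (intro smooth_on_dderiv \<Phi>)+

lemma has_derivative_vol:
  assumes q: "q \<in> V"
  shows "(vol has_derivative (\<lambda>v. \<Phi> q \<bullet> (\<Phi>1 q \<times> dderiv \<Phi>2 q v + dderiv \<Phi>1 q v \<times> \<Phi>2 q)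
    + dderiv \<Phi> q v \<bullet> (\<Phi>1 q \<times> \<Phi>2 q))) (at q)"
  unfolding vol_def[abs_def]
  by (intro has_derivative_inner has_derivative_cross3 dderiv_has_derivative
      smooth_on_differentiable[OF \<Phi> q] smooth_on_differentiable[OF smooth_\<Phi>12(1) q]
      smooth_on_differentiable[OF smooth_\<Phi>12(2) q])

lemma differentiable_conormal:
  assumes q: "q \<in> V"
  shows "conormal differentiable (at q)"
proof -
  have "(\<lambda>q. \<Phi>1 q \<times> \<Phi>2 q) differentiable (at q)"
    by (rule differentiableI[OF has_derivative_cross3[OF dderiv_has_derivative dderiv_has_derivative]])
       (intro smooth_on_differentiable[OF _ q] smooth_\<Phi>12)+
  moreover have "(\<lambda>q. 1 / vol q) differentiable (at q)"
    using vol_nonzero[OF q] differentiableI[OF has_derivative_vol[OF q]]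
    by (intro differentiable_divide differentiable_const)
  ultimately show ?thesis
    unfolding conormal_def[abs_def] by (intro differentiable_scaleR)
qed

text \<open>Equiaffinity is automatic here, since the derivative of the position vector is
  tangent.\<close>

sublocale conormal_field V \<Phi> \<Phi> conormal
proof (unfold_locales)
  fix q v assume q: "q \<in> V"
  have "gauss_frame \<Phi> \<Phi> q (v, 0) = dderiv \<Phi> q v"
    by (simp add: gauss_frame_def)
  then have "inv (gauss_frame \<Phi> \<Phi> q) (dderiv \<Phi> q v) = (v, 0)"
    by (rule inv_f_eq[OF bij_is_inj[OF frame[OF q]]])
  then show "transversal \<Phi> \<Phi> q (dderiv \<Phi> q v) = 0"
    by (simp add: transversal_def)
qed (use V \<Phi> frame differentiable_conormal conormal_\<Phi> conormal_d\<Phi> smooth_on_differentiable in auto)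

text \<open>Differentiating one vector of the triple product keeps only its component along that
  same vector. So the logarithmic derivative of the volume is the trace of the connection form: the
  induced volume is parallel.\<close>

lemma dderiv_vol:
  assumes q: "q \<in> V"
  shows "dderiv vol q v = vol q * (\<Gamma> q v (axis 1 1) $ 1 + \<Gamma> q v (axis 2 1) $ 2)"
proof -
  have "dderiv \<Phi>1 q v = d2 q v (axis 1 1)" "dderiv \<Phi>2 q v = d2 q v (axis 2 1)"
    by (simp_all add: \<Phi>1_def[abs_def] \<Phi>2_def[abs_def])
  then have "\<exists>c. dderiv \<Phi>1 q v = \<Gamma> q v (axis 1 1) $ 1 *\<^sub>R \<Phi>1 q + \<Gamma> q v (axis 1 1) $ 2 *\<^sub>R \<Phi>2 q + c *\<^sub>R \<Phi> q"
    "\<exists>c. dderiv \<Phi>2 q v = \<Gamma> q v (axis 2 1) $ 1 *\<^sub>R \<Phi>1 q + \<Gamma> q v (axis 2 1) $ 2 *\<^sub>R \<Phi>2 q + c *\<^sub>R \<Phi> q"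
    using gauss_frame_split[OF q, of "d2 q v (axis 1 1)"] gauss_frame_split[OF q, of "d2 q v (axis 2 1)"]
    unfolding d\<Phi>_expansion[OF q] by metis+
  then obtain c1 c2 where
    "dderiv \<Phi>1 q v = \<Gamma> q v (axis 1 1) $ 1 *\<^sub>R \<Phi>1 q + \<Gamma> q v (axis 1 1) $ 2 *\<^sub>R \<Phi>2 q + c1 *\<^sub>R \<Phi> q"
    "dderiv \<Phi>2 q v = \<Gamma> q v (axis 2 1) $ 1 *\<^sub>R \<Phi>1 q + \<Gamma> q v (axis 2 1) $ 2 *\<^sub>R \<Phi>2 q + c2 *\<^sub>R \<Phi> q"
    by blast
  then show ?thesis
    by (simp add: dderiv_eqI[OF has_derivative_vol[OF q]] d\<Phi>_expansion[OF q] cross_add_left cross_add_right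
        cross_mult_left cross_mult_right inner_add_right inner_add_left dot_cross_self vol_def algebra_simps)
qed

abbreviation "h11 q \<equiv> h q (axis 1 1) (axis 1 1)"
abbreviation "h12 q \<equiv> h q (axis 1 1) (axis 2 1)"
abbreviation "h22 q \<equiv> h q (axis 2 1) (axis 2 1)"

text \<open>The hypothesis equates the induced volume with the metric volume. Differentiating it
  contracts the adjugate of \<open>h\<close> with the derivative of \<open>h\<close>, and
  \<open>dderiv_vol\<close> supplies exactly the connection terms that complete this derivative to
  \<open>nabla_h\<close>. The result is the trace of the cubic form multiplied by the Gram
  determinant.\<close>

lemma apolarity:
  assumes vol: "\<And>q. q \<in> V \<Longrightarrow> (vol q)\<^sup>2 = h11 q * h22 q - (h12 q)\<^sup>2" and q: "q \<in> V"
  shows "h22 q * nabla_h q v (axis 1 1) (axis 1 1) - 2 * h12 q * nabla_h q v (axis 1 1) (axis 2 1)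
    + h11 q * nabla_h q v (axis 2 1) (axis 2 1) = 0"
proof -
  have dh: "((\<lambda>q. h q v w) has_derivative dderiv (\<lambda>q. h q v w) q) (at q)" for v w
    by (rule dderiv_has_derivative[OF differentiable_affine_metric[OF q]])
  have d1: "((\<lambda>q. h11 q * h22 q - (h12 q)\<^sup>2) has_derivative (\<lambda>v. h11 q * dderiv h22 q v + dderiv h11 q v * h22 q
      - 2 * h12 q * dderiv h12 q v)) (at q)"
    by (rule derivative_eq_intros dh refl)+ (simp add: mult_ac)
  have d2: "((\<lambda>q. (vol q)\<^sup>2) has_derivative (\<lambda>v. 2 * vol q * dderiv vol q v)) (at q)"
    by (rule derivative_eq_intros dderiv_has_derivative differentiableI[OF has_derivative_vol[OF q]] refl)+ (simp add: mult_ac)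
  have "dderiv (\<lambda>q. h11 q * h22 q - (h12 q)\<^sup>2) q = dderiv (\<lambda>q. (vol q)\<^sup>2) q"
    by (rule dderiv_cong_open[OF V q]) (simp_all add: vol differentiableI[OF d2])
  then have "h11 q * dderiv h22 q v + dderiv h11 q v * h22 q - 2 * h12 q * dderiv h12 q v
      = 2 * vol q * dderiv vol q v"
    unfolding dderiv_eqI[OF d1] dderiv_eqI[OF d2] by metis
  also have "\<dots> = 2 * (h11 q * h22 q - (h12 q)\<^sup>2) * (\<Gamma> q v (axis 1 1) $ 1 + \<Gamma> q v (axis 2 1) $ 2)"
    unfolding vol[OF q, symmetric] dderiv_vol[OF q] by (simp add: power2_eq_square)
  finally have eq: "h11 q * dderiv h22 q v + dderiv h11 q v * h22 q - 2 * h12 q * dderiv h12 q v = \<dots>" .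
  note bl = bilinear_affine_metric[OF q]
  have hl: "h q X (axis i 1) = X$1 * h q (axis 1 1) (axis i 1) + X$2 * h q (axis 2 1) (axis i 1)"
    and hr: "h q (axis i 1) X = X$1 * h q (axis i 1) (axis 1 1) + X$2 * h q (axis i 1) (axis 2 1)" for X i
    by (subst real2_expansion[of X], simp add: bilinear_ladd[OF bl] bilinear_lmul[OF bl] bilinear_radd[OF bl] bilinear_rmul[OF bl])+
  have h21: "h q (axis 2 1) (axis 1 1) = h12 q" by (rule affine_metric_sym[OF q])
  show ?thesis
    using eq unfolding nabla_h_def hl[of "\<Gamma> q v w" for w] hr[of _ "\<Gamma> q v w" for w] h21
    by (simp add: algebra_simps power2_eq_square)
qed

end

section \<open>The hypersurface over a centroaffine surface\<close>

text \<open>\<open>emb\<close> and \<open>tail\<close> express the splitting of 4-space into the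
  axis of the first curve component and the space containing \<open>\<Phi>\<close>;
  \<open>proj\<close> and \<open>lift\<close> express the splitting of the coordinates into t and
  (u, v).\<close>

definition emb :: "real \<Rightarrow> real^3 \<Rightarrow> real^4" where
  "emb a z = vector [a, z$1, z$2, z$3]"

definition tail :: "real^4 \<Rightarrow> real^3" where
  "tail w = vector [w$2, w$3, w$4]"

definition proj :: "real^3 \<Rightarrow> real^2" where
  "proj y = vector [y$2, y$3]"

definition lift :: "real^2 \<Rightarrow> real^3" where
  "lift X = vector [0, X$1, X$2]"

lemma emb_nth [simp]: "emb a z $ 1 = a" "emb a z $ 2 = z$1" "emb a z $ 3 = z$2" "emb a z $ 4 = z$3"
  by (simp_all add: emb_def vector_def)

lemma tail_nth [simp]: "tail w $ 1 = w$2" "tail w $ 2 = w$3" "tail w $ 3 = w$4"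
  by (simp_all add: tail_def)

lemma proj_nth [simp]: "proj y $ 1 = y$2" "proj y $ 2 = y$3"
  by (simp_all add: proj_def)

lemma lift_nth [simp]: "lift X $ 1 = 0" "lift X $ 2 = X$1" "lift X $ 3 = X$2"
  by (simp_all add: lift_def)

lemma emb_tail: "emb (w$1) (tail w) = w"
  by (simp add: vec_eq_iff forall_4)

lemma tail_emb [simp]: "tail (emb a z) = z"
  by (simp add: vec_eq_iff forall_3)

lemma emb_eq_iff [simp]: "emb a z = emb b w \<longleftrightarrow> a = b \<and> z = w"
  by (auto simp: vec_eq_iff forall_4 forall_3)

lemma emb_eq_0_iff [simp]: "emb a z = 0 \<longleftrightarrow> a = 0 \<and> z = 0"
  by (auto simp: vec_eq_iff forall_4 forall_3)

lemma emb_add: "emb a z + emb b w = emb (a + b) (z + w)"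
  by (simp add: vec_eq_iff forall_4)

lemma emb_scaleR: "c *\<^sub>R emb a z = emb (c * a) (c *\<^sub>R z)"
  by (simp add: vec_eq_iff forall_4)

lemma emb_inner [simp]: "emb a z \<bullet> emb b w = a * b + z \<bullet> w"
  by (simp add: inner_vec_def sum_4 sum_3)

lemma bounded_linear_emb: "bounded_linear (\<lambda>(a, z). emb a z)"
  by (intro linear_conv_bounded_linear[THEN iffD1] linearI) (auto simp: emb_add emb_scaleR)

lemma has_derivative_emb:
  assumes "(a has_derivative a') (at p)" "(z has_derivative z') (at p)"
  shows "((\<lambda>y. emb (a y) (z y)) has_derivative (\<lambda>v. emb (a' v) (z' v))) (at p)"
  using bounded_linear.has_derivative[OF bounded_linear_emb has_derivative_Pair[OF assms]] by simp

lemma bounded_linear_tail: "bounded_linear tail"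
  by (intro linear_conv_bounded_linear[THEN iffD1] linearI) (auto simp: vec_eq_iff forall_3)

lemma bounded_linear_proj: "bounded_linear proj"
  by (intro linear_conv_bounded_linear[THEN iffD1] linearI) (auto simp: vec_eq_iff forall_2)

lemma linear_proj: "linear proj"
  using bounded_linear_proj bounded_linear.linear by blast

lemmas proj_add = linear_add[OF linear_proj] and proj_scaleR = linear_cmul[OF linear_proj]

lemma proj_lift [simp]: "proj (lift X) = X"
  by (simp add: vec_eq_iff forall_2)

lemma proj_axis [simp]: "proj (axis 1 c) = 0"
  by (simp add: vec_eq_iff forall_2 axis_def)

lemma axis_lift: "proj v = 0 \<Longrightarrow> v = v$1 *\<^sub>R axis 1 1"
  by (simp add: vec_eq_iff forall_3 forall_2 axis_def)

lemma open_coordinate_product: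
  assumes "open I" "open V"
  shows "open {y. y$1 \<in> I \<and> proj y \<in> V}"
proof -
  have "{y. y$1 \<in> I \<and> proj y \<in> V} = (\<lambda>y. y$1) -` I \<inter> proj -` V" by auto
  then show ?thesis
    by (simp add: open_Int continuous_open_vimage assms linear_continuous_at bounded_linear_proj bounded_linear_vec_nth)
qed

text \<open>Expansion along the first column. The two middle rows stand for surface directions,
  which have no component along the axis.\<close>

lemma det_emb:
  "det (vector [emb a u, emb 0 v, emb 0 w, emb d z] :: real^4^4)
    = a * (z \<bullet> (v \<times> w)) - d * (u \<bullet> (v \<times> w))"
proof -
  let ?A = "vector [emb a u, emb 0 v, emb 0 w, emb d z] :: real^4^4"
  have "?A $ 1 = emb a u" "?A $ 2 = emb 0 v" "?A $ 3 = emb 0 w" "?A $ 4 = emb d z"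
    by (simp_all add: vector_def)
  then show ?thesis
    unfolding det_4 Let_def
    by (simp add: cross_components inner_vec_def sum_3) (simp add: algebra_simps)
qed

text \<open>On the line through \<open>y\<close> in direction \<open>lift X\<close> the function is
  constant near the parameter 0, because \<open>W\<close> is open.\<close>

lemma dderiv_first_coordinate:
  fixes a :: "real^3 \<Rightarrow> 'b::real_normed_vector"
  assumes W: "open W" "y \<in> W" and a: "a differentiable (at y)"
    and const: "\<And>z. z \<in> W \<Longrightarrow> z$1 = y$1 \<Longrightarrow> a z = a y"
  shows "dderiv a y (lift X) = 0"
proof -
  have line: "((\<lambda>s::real. y + s *\<^sub>R lift X) has_derivative (\<lambda>s. s *\<^sub>R lift X)) (at 0)"
    by (auto intro!: derivative_eq_intros)
  have "((\<lambda>s. a (y + s *\<^sub>R lift X)) has_derivative (\<lambda>s. dderiv a y (s *\<^sub>R lift X))) (at 0)"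
    using diff_chain_at[OF line, of a "dderiv a y"] dderiv_has_derivative[OF a] by (simp add: o_def)
  moreover have "((\<lambda>s. a (y + s *\<^sub>R lift X)) has_derivative (\<lambda>s. 0)) (at 0)"
  proof (rule has_derivative_transform_within_open[of "\<lambda>_. a y"])
    show "open ((\<lambda>s::real. y + s *\<^sub>R lift X) -` W)"
      by (intro continuous_open_vimage W continuous_intros)
    show "a y = a (y + s *\<^sub>R lift X)" if "s \<in> (\<lambda>s. y + s *\<^sub>R lift X) -` W" for s
      using that by (intro const[symmetric]) auto
  qed (use W in auto)
  ultimately have "(\<lambda>s. dderiv a y (s *\<^sub>R lift X)) = (\<lambda>s. 0)"
    by (rule has_derivative_unique)
  from fun_cong[OF this, of 1] show ?thesis by simp
qed

text \<open>Translation by \<open>y' - y\<close> preserves the first coordinate, so near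
  \<open>y\<close> the function agrees with its translate.\<close>

lemma dderiv_first_coordinate_eq:
  fixes a :: "real^3 \<Rightarrow> 'b::real_normed_vector"
  assumes W: "open W" "y \<in> W" "y' \<in> W" "y$1 = y'$1" and a: "a differentiable (at y)" "a differentiable (at y')"
    and const: "\<And>z z'. z \<in> W \<Longrightarrow> z' \<in> W \<Longrightarrow> z$1 = z'$1 \<Longrightarrow> a z = a z'"
  shows "dderiv a y v = dderiv a y' v"
proof -
  define d where "d = y' - y"
  have d: "d $ 1 = 0" "y + d = y'" using W by (auto simp: d_def)
  have "((\<lambda>q. q + d) has_derivative (\<lambda>v. v)) (at y)"
    by (auto intro!: derivative_eq_intros)
  from diff_chain_at[OF this, of a "dderiv a y'"] have
    D: "((\<lambda>q. a (q + d)) has_derivative dderiv a y') (at y)"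
    using dderiv_has_derivative[OF a(2)] by (simp add: d o_def)
  have "dderiv a y = dderiv (\<lambda>q. a (q + d)) y"
  proof (rule dderiv_cong_open)
    show "open (W \<inter> (\<lambda>q. q + d) -` W)"
      by (intro open_Int continuous_open_vimage W continuous_intros)
    show "y \<in> W \<inter> (\<lambda>q. q + d) -` W" using W d by simp
    show "a q = a (q + d)" if "q \<in> W \<inter> (\<lambda>q. q + d) -` W" for q
      using that d by (intro const) auto
  qed (rule differentiableI[OF D])
  then show ?thesis using dderiv_eqI[OF D] by simp
qed

text \<open>One chart of the hypersurface. The centroaffine metric \<open>c.h\<close> can be
  definite of either sign, hence the absolute values in \<open>\<Phi>_volume\<close>. Both volume
  conditions are assumed because their comparison fixes the scale of the conormal.\<close>

locale warped_immersion = c: centroaffine_surface V \<Phi>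
  for V :: "(real^2) set" and \<Phi> :: "real^2 \<Rightarrow> real^3" +
  fixes I :: "real set" and \<gamma> :: "real \<Rightarrow> real^2" and \<zeta> :: "real^3 \<Rightarrow> real^4"
    and W :: "(real^3) set" and F :: "real^3 \<Rightarrow> real^4"
  defines W_def: "W \<equiv> {y. y$1 \<in> I \<and> proj y \<in> V}"
    and F_def: "F \<equiv> (\<lambda>y. emb (\<gamma> (y$1) $ 1) (\<gamma> (y$1) $ 2 *\<^sub>R \<Phi> (proj y)))"
  assumes I: "open I" and \<gamma>: "smooth_on I \<gamma>"
    and F: "smooth_on W F" and \<zeta>: "smooth_on W \<zeta>"
    and F_frame: "\<And>y. y \<in> W \<Longrightarrow> bij (gauss_frame F \<zeta> y)"
    and F_equiaffine: "\<And>y v. y \<in> W \<Longrightarrow> transversal F \<zeta> y (dderiv \<zeta> y v) = 0"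
    and pos: "\<And>y v. y \<in> W \<Longrightarrow> v \<noteq> 0 \<Longrightarrow> affine_metric F \<zeta> y v v > 0"
    and \<Phi>_volume: "\<And>q X Y. q \<in> V \<Longrightarrow> \<bar>c.h q X X\<bar> = 1 \<Longrightarrow> \<bar>c.h q Y Y\<bar> = 1 \<Longrightarrow> c.h q X Y = 0 \<Longrightarrow>
      \<bar>\<Phi> q \<bullet> (dderiv \<Phi> q X \<times> dderiv \<Phi> q Y)\<bar> = 1"
    and F_volume: "\<And>y X Y Z. y \<in> W \<Longrightarrow>
      affine_metric F \<zeta> y X X = 1 \<Longrightarrow> affine_metric F \<zeta> y Y Y = 1 \<Longrightarrow> affine_metric F \<zeta> y Z Z = 1 \<Longrightarrow>
      affine_metric F \<zeta> y X Y = 0 \<Longrightarrow> affine_metric F \<zeta> y X Z = 0 \<Longrightarrow> affine_metric F \<zeta> y Y Z = 0 \<Longrightarrow>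
      \<bar>det (vector [dderiv F y X, dderiv F y Y, dderiv F y Z, \<zeta> y])\<bar> = 1"
begin

section \<open>Derivatives of the immersion and the block form of its metric\<close>

lemma W: "open W"
  unfolding W_def by (rule open_coordinate_product[OF I c.V])

lemma W_D: "y \<in> W \<Longrightarrow> y$1 \<in> I" "y \<in> W \<Longrightarrow> proj y \<in> V"
  by (auto simp: W_def)

definition "\<gamma>' t = dderiv \<gamma> t 1"
definition "\<gamma>'' t = dderiv \<gamma>' t 1"

lemma has_derivative_line:
  fixes g :: "real \<Rightarrow> real^2"
  assumes "smooth_on I g" "y$1 \<in> I"
  shows "((\<lambda>y::real^3. g (y$1) $ i) has_derivative (\<lambda>v. v$1 * dderiv g (y$1) 1 $ i)) (at y)"
proof -
  have g: "g differentiable (at (y$1))" by (rule smooth_on_differentiable[OF assms])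
  define d where "d = dderiv g (y$1) 1"
  have "dderiv g (y$1) = (\<lambda>s. s *\<^sub>R d)"
  proof
    show "dderiv g (y$1) s = s *\<^sub>R d" for s
      using linear_cmul[OF linear_dderiv[OF g], of s 1] by (simp add: d_def)
  qed
  with dderiv_has_derivative[OF g] have "(g has_derivative (\<lambda>s. s *\<^sub>R d)) (at (y$1))"
    by simp
  from diff_chain_at[OF bounded_linear_imp_has_derivative[OF bounded_linear_vec_nth] this]
  have "((\<lambda>y. g (y$1)) has_derivative (\<lambda>v. v$1 *\<^sub>R d)) (at y)"
    by (simp add: o_def)
  from bounded_linear.has_derivative[OF bounded_linear_vec_nth this]
  show ?thesis by (simp add: d_def)
qed

lemma smooth_\<gamma>': "smooth_on I \<gamma>'"
  unfolding \<gamma>'_def[abs_def] by (rule smooth_on_dderiv[OF \<gamma>])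

lemma has_derivative_\<gamma>:
  "y \<in> W \<Longrightarrow> ((\<lambda>y. \<gamma> (y$1) $ i) has_derivative (\<lambda>v. v$1 * \<gamma>' (y$1) $ i)) (at y)"
  "y \<in> W \<Longrightarrow> ((\<lambda>y. \<gamma>' (y$1) $ i) has_derivative (\<lambda>v. v$1 * \<gamma>'' (y$1) $ i)) (at y)"
  using has_derivative_line[OF \<gamma> W_D(1)] has_derivative_line[OF smooth_\<gamma>' W_D(1)]
  by (simp_all only: \<gamma>'_def[of "y$1"] \<gamma>''_def)

lemma has_derivative_proj:
  assumes "g differentiable (at (proj y))"
  shows "((\<lambda>y. g (proj y)) has_derivative (\<lambda>v. dderiv g (proj y) (proj v))) (at y)"
  using diff_chain_at[OF bounded_linear_imp_has_derivative[OF bounded_linear_proj] dderiv_has_derivative[OF assms]]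
  by (simp add: o_def)

lemmas has_derivative_\<Phi> = has_derivative_proj[OF smooth_on_differentiable[OF c.\<Phi> W_D(2)]]
  and has_derivative_d\<Phi> = has_derivative_proj[OF smooth_on_differentiable[OF c.smooth_dderiv W_D(2)]]
  and has_derivative_conormal = has_derivative_proj[OF c.differentiable_conormal[OF W_D(2)]]

lemma dF:
  assumes "y \<in> W"
  shows "dderiv F y v = emb (v$1 * \<gamma>' (y$1) $ 1)
    (\<gamma> (y$1) $ 2 *\<^sub>R dderiv \<Phi> (proj y) (proj v) + (v$1 * \<gamma>' (y$1) $ 2) *\<^sub>R \<Phi> (proj y))"
proof -
  have "(F has_derivative (\<lambda>v. emb (v$1 * \<gamma>' (y$1) $ 1)
    (\<gamma> (y$1) $ 2 *\<^sub>R dderiv \<Phi> (proj y) (proj v) + (v$1 * \<gamma>' (y$1) $ 2) *\<^sub>R \<Phi> (proj y)))) (at y)"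
    unfolding F_def
    by (intro has_derivative_emb has_derivative_scaleR has_derivative_\<gamma> has_derivative_\<Phi> assms)
  then show ?thesis by (rule dderiv_eqI[THEN fun_cong])
qed

lemma d2F:
  assumes y: "y \<in> W"
  shows "dderiv (\<lambda>y. dderiv F y w) y v = emb (w$1 * (v$1 * \<gamma>'' (y$1) $ 1))
    ((\<gamma> (y$1) $ 2 *\<^sub>R c.d2 (proj y) (proj v) (proj w) + (v$1 * \<gamma>' (y$1) $ 2) *\<^sub>R dderiv \<Phi> (proj y) (proj w))
     + ((w$1 * \<gamma>' (y$1) $ 2) *\<^sub>R dderiv \<Phi> (proj y) (proj v) + (w$1 * (v$1 * \<gamma>'' (y$1) $ 2)) *\<^sub>R \<Phi> (proj y)))"
proof -
  let ?G = "\<lambda>y. emb (w$1 * \<gamma>' (y$1) $ 1)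
    (\<gamma> (y$1) $ 2 *\<^sub>R dderiv \<Phi> (proj y) (proj w) + (w$1 * \<gamma>' (y$1) $ 2) *\<^sub>R \<Phi> (proj y))"
  have D: "(?G has_derivative (\<lambda>v. emb (w$1 * (v$1 * \<gamma>'' (y$1) $ 1))
    ((\<gamma> (y$1) $ 2 *\<^sub>R c.d2 (proj y) (proj v) (proj w) + (v$1 * \<gamma>' (y$1) $ 2) *\<^sub>R dderiv \<Phi> (proj y) (proj w))
     + ((w$1 * \<gamma>' (y$1) $ 2) *\<^sub>R dderiv \<Phi> (proj y) (proj v) + (w$1 * (v$1 * \<gamma>'' (y$1) $ 2)) *\<^sub>R \<Phi> (proj y))))) (at y)"
    by (intro has_derivative_emb has_derivative_scaleR has_derivative_add has_derivative_mult_right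
        has_derivative_\<gamma> has_derivative_\<Phi> has_derivative_d\<Phi> y)
  have "dderiv (\<lambda>y. dderiv F y w) y = dderiv ?G y"
    by (rule dderiv_cong_open[OF W y dF differentiableI[OF D]])
  then show ?thesis using dderiv_eqI[OF D] by simp
qed

definition "\<nu>0 y = emb (- (\<gamma>' (y$1) $ 2)) (\<gamma>' (y$1) $ 1 *\<^sub>R c.conormal (proj y))"
definition "lam y = 1 / (\<nu>0 y \<bullet> \<zeta> y)"
definition "\<nu> y = lam y *\<^sub>R \<nu>0 y"

lemma has_derivative_\<nu>0:
  assumes y: "y \<in> W"
  shows "(\<nu>0 has_derivative (\<lambda>v. emb (- (v$1 * \<gamma>'' (y$1) $ 2))
    (\<gamma>' (y$1) $ 1 *\<^sub>R dderiv c.conormal (proj y) (proj v) + (v$1 * \<gamma>'' (y$1) $ 1) *\<^sub>R c.conormal (proj y)))) (at y)"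
  unfolding \<nu>0_def[abs_def]
  by (intro has_derivative_emb has_derivative_scaleR has_derivative_minus
        has_derivative_\<gamma> has_derivative_conormal y)

lemma \<nu>0_dF: "y \<in> W \<Longrightarrow> \<nu>0 y \<bullet> dderiv F y v = 0"
  by (simp add: \<nu>0_def dF inner_add_right c.conormal_\<Phi> c.conormal_d\<Phi> W_D)

lemma \<gamma>'_nonzero:
  assumes y: "y \<in> W"
  shows "\<gamma>' (y$1) $ 1 \<noteq> 0 \<or> \<gamma>' (y$1) $ 2 \<noteq> 0"
proof (rule ccontr)
  assume "\<not> ?thesis"
  then have "gauss_frame F \<zeta> y (axis 1 1, 0) = 0" "gauss_frame F \<zeta> y (0, 0) = 0"
    using linear_0[OF c.linear_d\<Phi>[OF W_D(2)[OF y]]]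
    by (simp_all add: gauss_frame_def dF[OF y] linear_0[OF linear_proj])
  then have "(axis 1 1 :: real^3, 0 :: real) = (0, 0)"
    using bij_is_inj[OF F_frame[OF y]] by (metis injD)
  then show False by (simp add: axis_eq_0_iff)
qed

text \<open>A covector that vanishes on the tangent space and on the normal is zero, and since the
  conormal of \<open>\<Phi>\<close> is nonzero this would make the velocity of the curve
  vanish.\<close>

lemma \<nu>0_\<zeta>:
  assumes y: "y \<in> W"
  shows "\<nu>0 y \<bullet> \<zeta> y \<noteq> 0"
proof
  assume 0: "\<nu>0 y \<bullet> \<zeta> y = 0"
  have "\<nu>0 y \<bullet> w = 0" for w
  proof -
    obtain v b where "w = gauss_frame F \<zeta> y (v, b)"
      using bij_is_surj[OF F_frame[OF y]] by (metis surjD surj_pair)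
    then show ?thesis using 0 by (simp add: gauss_frame_def inner_add_right \<nu>0_dF[OF y])
  qed
  then have "\<nu>0 y = 0" by (metis inner_eq_zero_iff)
  moreover have "c.conormal (proj y) \<noteq> 0" using c.conormal_\<Phi>[OF W_D(2)[OF y]] by auto
  ultimately show False
    using \<gamma>'_nonzero[OF y] by (auto simp: \<nu>0_def)
qed

lemma lam_nonzero: "y \<in> W \<Longrightarrow> lam y \<noteq> 0"
  by (simp add: lam_def \<nu>0_\<zeta>)

lemma differentiable_lam:
  assumes y: "y \<in> W"
  shows "lam differentiable (at y)"
proof -
  have "(\<lambda>y. \<nu>0 y \<bullet> \<zeta> y) differentiable (at y)"
    by (rule differentiableI[OF has_derivative_inner[OF has_derivative_\<nu>0[OF y]
          dderiv_has_derivative[OF smooth_on_differentiable[OF \<zeta> y]]]])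
  then show ?thesis
    unfolding lam_def[abs_def] using \<nu>0_\<zeta>[OF y] by (intro differentiable_divide differentiable_const)
qed

sublocale m: conormal_field W F \<zeta> \<nu>
proof
  show "\<nu> differentiable (at y)" if "y \<in> W" for y
    unfolding \<nu>_def[abs_def]
    using differentiable_lam[OF that] differentiableI[OF has_derivative_\<nu>0[OF that]]
    by (rule differentiable_scaleR)
  show "\<nu> y \<bullet> \<zeta> y = 1" if "y \<in> W" for y
    using \<nu>0_\<zeta>[OF that] by (simp add: \<nu>_def lam_def)
qed (use W F F_frame F_equiaffine smooth_on_differentiable[OF \<zeta>] \<nu>0_dF in \<open>auto simp: \<nu>_def\<close>)

text \<open>\<open>wr\<close> is the determinant of velocity and acceleration of the curve;
  \<open>rho\<close> is the conformal factor of the metric in the surface directions.\<close>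

definition "wr t = \<gamma>' t $ 1 * \<gamma>'' t $ 2 - \<gamma>' t $ 2 * \<gamma>'' t $ 1"
definition "rho y = lam y * \<gamma>' (y$1) $ 1 * \<gamma> (y$1) $ 2"

text \<open>There are no cross terms because the mixed second derivatives of \<open>F\<close> are
  tangent to the surface, where the conormal vanishes.\<close>

lemma metric:
  assumes y: "y \<in> W"
  shows "m.h y v w = lam y * wr (y$1) * (v$1 * w$1) + rho y * c.h (proj y) (proj v) (proj w)"
  unfolding m.affine_metric_eq[OF y] d2F[OF y] \<nu>_def \<nu>0_def
  using c.conormal_\<Phi>[OF W_D(2)[OF y]] c.conormal_d\<Phi>[OF W_D(2)[OF y]]
  by (simp add: inner_add_right c.affine_metric_eq[OF W_D(2)[OF y]] wr_def rho_def algebra_simps)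

end

section \<open>Volume conditions and dependence on the first coordinate only\<close>

context warped_immersion
begin

abbreviation "e1 \<equiv> axis 1 1 :: real^3"

lemma metric_simps:
  assumes "y \<in> W"
  shows "m.h y e1 e1 = lam y * wr (y$1)" "m.h y e1 (lift X) = 0" "m.h y (lift X) e1 = 0"
    "m.h y (lift X) (lift Y) = rho y * c.h (proj y) X Y"
  using c.bilinear_affine_metric[OF W_D(2)[OF assms]]
  by (simp_all add: metric[OF assms] bilinear_lzero bilinear_rzero axis_nth)

lemma rho_pos:
  assumes y: "y \<in> W" and X: "X \<noteq> 0"
  shows "rho y * c.h (proj y) X X > 0"
proof -
  have "lift X \<noteq> 0" using X by (metis proj_lift linear_0[OF linear_proj])
  from pos[OF y this] show ?thesis by (simp add: metric_simps[OF y])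
qed

lemma rho_nonzero: "y \<in> W \<Longrightarrow> rho y \<noteq> 0"
  using rho_pos[of y "axis 1 1"] by (auto simp: axis_eq_0_iff)

lemma c_nondegenerate:
  assumes y: "y \<in> W" and "\<forall>Y. c.h (proj y) X Y = 0"
  shows "X = 0"
  using rho_pos[OF y, of X] assms(2) by auto

text \<open>Both volume conditions are evaluated on one basis \<open>X\<close>, \<open>Y\<close>
  that is orthonormal for \<open>rho\<close> times the centroaffine metric. Eliminating its area
  \<delta> and the volume of \<open>\<Phi>\<close> between them leaves an equation for
  \<open>lam\<close>; comparing the surface condition with the Gram determinant gives the second
  claim.\<close>

lemma volumes:
  assumes y: "y \<in> W"
  shows "lam y ^ 5 * (wr (y$1) * (\<gamma>' (y$1) $ 1)\<^sup>2) = (\<gamma> (y$1) $ 2)\<^sup>2"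
    and "(c.vol (proj y))\<^sup>2 = c.h11 (proj y) * c.h22 (proj y) - (c.h12 (proj y))\<^sup>2"
proof -
  define q t where "q = proj y" and "t = y$1"
  have q: "q \<in> V" unfolding q_def by (rule W_D(2)[OF y])
  define b where "b X Y = rho y * c.h q X Y" for X Y
  note cb = c.bilinear_affine_metric[OF q]
  note cb_simps = bilinear_lmul[OF cb] bilinear_rmul[OF cb]
  have b: "bilinear b" using cb unfolding b_def bilinear_def linear_iff by (simp add: algebra_simps)
  have b_sym: "b X Y = b Y X" for X Y by (simp add: b_def c.affine_metric_sym[OF q, of X Y])
  have b_pos: "\<forall>X. X \<noteq> 0 \<longrightarrow> b X X > 0" using rho_pos[OF y] by (simp add: b_def q_def)
  obtain X Y where XY: "b X X = 1" "b Y Y = 1" "b X Y = 0"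
    "(X$1 * Y$2 - X$2 * Y$1)\<^sup>2 * (b (axis 1 1) (axis 1 1) * b (axis 2 1) (axis 2 1) - (b (axis 1 1) (axis 2 1))\<^sup>2) = 1"
    using gram_schmidt_2[OF b b_sym b_pos] by (elim exE conjE) (rule that; assumption)
  define \<delta> where "\<delta> = X$1 * Y$2 - X$2 * Y$1"
  \<comment> \<open>Rescaling from \<open>b\<close> back to \<open>c.h\<close>: only the absolute
    value of \<open>rho y\<close> is available for the root, so unit squares are recovered up to
    sign.\<close>
  define r where "r = sqrt \<bar>rho y\<bar>"
  have r: "r * r = \<bar>rho y\<bar>" by (simp add: r_def)
  have rho0: "rho y \<noteq> 0" by (rule rho_nonzero[OF y])
  have "\<bar>c.h q (r *\<^sub>R X) (r *\<^sub>R X)\<bar> = \<bar>b X X\<bar>" "\<bar>c.h q (r *\<^sub>R Y) (r *\<^sub>R Y)\<bar> = \<bar>b Y Y\<bar>"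
    by (simp_all add: cb_simps b_def abs_mult flip: r mult.assoc)
  moreover have "c.h q (r *\<^sub>R X) (r *\<^sub>R Y) = 0"
    using XY(3) rho0 by (simp add: cb_simps b_def)
  ultimately have "\<bar>\<Phi> q \<bullet> (dderiv \<Phi> q (r *\<^sub>R X) \<times> dderiv \<Phi> q (r *\<^sub>R Y))\<bar> = 1"
    using XY(1,2) by (intro \<Phi>_volume q) simp_all
  moreover have "dderiv \<Phi> q (r *\<^sub>R X) \<times> dderiv \<Phi> q (r *\<^sub>R Y) = (r * r * \<delta>) *\<^sub>R (c.\<Phi>1 q \<times> c.\<Phi>2 q)"
    unfolding c.cross_d\<Phi>[OF q] \<delta>_def by (simp add: algebra_simps)
  ultimately have "\<bar>rho y\<bar> * \<bar>\<delta>\<bar> * \<bar>c.vol q\<bar> = 1"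
    by (simp add: c.vol_def abs_mult r)
  then have "(\<bar>rho y\<bar> * \<bar>\<delta>\<bar> * \<bar>c.vol q\<bar>)\<^sup>2 = 1" by simp
  then have vol: "(rho y)\<^sup>2 * \<delta>\<^sup>2 * (c.vol q)\<^sup>2 = 1" by (simp add: power_mult_distrib)
  have gram: "(rho y)\<^sup>2 * \<delta>\<^sup>2 * (c.h11 q * c.h22 q - (c.h12 q)\<^sup>2) = 1"
    using XY(4) by (simp add: b_def \<delta>_def power2_eq_square algebra_simps)
  have "(rho y)\<^sup>2 * \<delta>\<^sup>2 \<noteq> 0" using vol by auto
  then show "(c.vol (proj y))\<^sup>2 = c.h11 (proj y) * c.h22 (proj y) - (c.h12 (proj y))\<^sup>2"
    using vol gram unfolding q_def[symmetric] by (metis mult_left_cancel)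
  have "e1 \<noteq> 0" by (simp add: axis_eq_0_iff)
  from pos[OF y this] have h11: "lam y * wr t > 0" by (simp add: metric_simps[OF y] t_def)
  \<comment> \<open>\<open>s *\<^sub>R e1\<close> completes the lifts of \<open>X\<close> and
    \<open>Y\<close> to an orthonormal frame of the hypersurface.\<close>
  define s where "s = 1 / sqrt (lam y * wr t)"
  have s: "s * s * (lam y * wr t) = 1" using h11 by (auto simp: s_def)
  note mb = m.bilinear_affine_metric[OF y]
  have "\<bar>det (vector [dderiv F y (s *\<^sub>R e1), dderiv F y (lift X), dderiv F y (lift Y), \<zeta> y])\<bar> = 1"
    using XY(1-3) s
    by (intro F_volume y) (simp_all add: metric_simps[OF y] bilinear_lmul[OF mb] bilinear_rmul[OF mb] b_def q_def t_def)
  also have "vector [dderiv F y (s *\<^sub>R e1), dderiv F y (lift X), dderiv F y (lift Y), \<zeta> y] =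
     (vector [emb (s * \<gamma>' t $ 1) ((s * \<gamma>' t $ 2) *\<^sub>R \<Phi> q), emb 0 (\<gamma> t $ 2 *\<^sub>R dderiv \<Phi> q X),
       emb 0 (\<gamma> t $ 2 *\<^sub>R dderiv \<Phi> q Y), emb (\<zeta> y $ 1) (tail (\<zeta> y))] :: real^4^4)"
    by (simp add: dF[OF y] emb_tail proj_scaleR linear_0[OF c.linear_d\<Phi>[OF q]] axis_nth flip: q_def t_def)
  also have "det \<dots> = s * \<gamma>' t $ 1 * (\<gamma> t $ 2 * \<gamma> t $ 2 * \<delta> * (tail (\<zeta> y) \<bullet> (c.\<Phi>1 q \<times> c.\<Phi>2 q)))
      - \<zeta> y $ 1 * (s * \<gamma>' t $ 2 * (\<gamma> t $ 2 * \<gamma> t $ 2 * \<delta> * c.vol q))"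
    unfolding det_emb by (simp add: cross_mult_left cross_mult_right c.cross_d\<Phi>[OF q] c.vol_def flip: \<delta>_def)
  also have "tail (\<zeta> y) \<bullet> (c.\<Phi>1 q \<times> c.\<Phi>2 q) = c.vol q * (c.conormal q \<bullet> tail (\<zeta> y))"
    using c.vol_nonzero[OF q] by (simp add: c.conormal_def inner_commute)
  \<comment> \<open>The two terms combine to \<open>\<nu>0\<close> paired with the normal, whose
    value is \<open>1 / lam y\<close>; this is how the scale enters.\<close>
  also have "s * \<gamma>' t $ 1 * (\<gamma> t $ 2 * \<gamma> t $ 2 * \<delta> * (c.vol q * (c.conormal q \<bullet> tail (\<zeta> y))))
      - \<zeta> y $ 1 * (s * \<gamma>' t $ 2 * (\<gamma> t $ 2 * \<gamma> t $ 2 * \<delta> * c.vol q))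
      = s * (\<gamma> t $ 2)\<^sup>2 * \<delta> * c.vol q * (\<nu>0 y \<bullet> emb (\<zeta> y $ 1) (tail (\<zeta> y)))"
    by (simp add: \<nu>0_def power2_eq_square algebra_simps flip: q_def t_def)
  also have "\<nu>0 y \<bullet> emb (\<zeta> y $ 1) (tail (\<zeta> y)) = 1 / lam y"
    by (simp add: emb_tail lam_def)
  finally have "(s * (\<gamma> t $ 2)\<^sup>2 * \<delta> * c.vol q * (1 / lam y))\<^sup>2 = 1"
    by (metis abs_power2 power_abs power_one)
  then have "(s * (\<gamma> t $ 2)\<^sup>2 * \<delta> * c.vol q)\<^sup>2 = (lam y)\<^sup>2"
    using lam_nonzero[OF y] by (simp add: power_mult_distrib power_divide divide_eq_eq)
  then have "(s * s * (lam y * wr t)) * ((rho y)\<^sup>2 * \<delta>\<^sup>2 * (c.vol q)\<^sup>2) * (\<gamma> t $ 2)^4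
      = (lam y)\<^sup>2 * (lam y * wr t) * (rho y)\<^sup>2"
    by (simp add: power2_eq_square power4_eq_xxxx algebra_simps)
  then have "(\<gamma> t $ 2)^4 = (lam y)\<^sup>2 * (lam y * wr t) * (rho y)\<^sup>2"
    unfolding s vol by simp
  \<comment> \<open>Each \<open>rho\<close> contains a factor \<open>lam\<close>, which makes the
    power five; one square of the second curve component will cancel.\<close>
  then have "(\<gamma> t $ 2)\<^sup>2 * (\<gamma> t $ 2)\<^sup>2 = (\<gamma> t $ 2)\<^sup>2 * (lam y ^ 5 * (wr t * (\<gamma>' t $ 1)\<^sup>2))"
    by (simp add: rho_def power2_eq_square power4_eq_xxxx eval_nat_numeral algebra_simps flip: t_def)
  moreover have "\<gamma> t $ 2 \<noteq> 0" using rho0 by (auto simp: rho_def t_def)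
  ultimately have "(\<gamma> t $ 2)\<^sup>2 = lam y ^ 5 * (wr t * (\<gamma>' t $ 1)\<^sup>2)"
    by (metis mult_left_cancel power_not_zero)
  then show "lam y ^ 5 * (wr (y$1) * (\<gamma>' (y$1) $ 1)\<^sup>2) = (\<gamma> (y$1) $ 2)\<^sup>2"
    by (simp add: t_def)
qed

lemma nonzero:
  assumes "y \<in> W"
  shows "\<gamma>' (y$1) $ 1 \<noteq> 0" "\<gamma> (y$1) $ 2 \<noteq> 0" "wr (y$1) \<noteq> 0"
proof -
  have "e1 \<noteq> 0" by (simp add: axis_eq_0_iff)
  from pos[OF assms this] rho_nonzero[OF assms]
  show "\<gamma>' (y$1) $ 1 \<noteq> 0" "\<gamma> (y$1) $ 2 \<noteq> 0" "wr (y$1) \<noteq> 0"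
    by (auto simp: rho_def metric_simps[OF assms])
qed

text \<open>The equation of \<open>volumes\<close> fixes the fifth power of \<open>lam\<close> by
  the curve at the given parameter, and an odd power is injective on the reals, so no sign ambiguity
  remains.\<close>

lemma lam_const:
  assumes "y \<in> W" "y' \<in> W" "y$1 = y'$1"
  shows "lam y = lam y'"
proof -
  have "lam y ^ 5 = lam y' ^ 5"
    using volumes(1)[OF assms(1)] volumes(1)[OF assms(2)] nonzero[OF assms(1)] assms(3)
    by (metis mult_right_cancel mult_eq_0_iff power_not_zero)
  then show ?thesis by (metis odd_real_root_power_cancel odd_numeral)
qed

lemma differentiable_\<gamma>:
  "y \<in> W \<Longrightarrow> (\<lambda>y. \<gamma> (y$1) $ i) differentiable (at y)"
  "y \<in> W \<Longrightarrow> (\<lambda>y. \<gamma>' (y$1) $ i) differentiable (at y)"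
  using has_derivative_\<gamma> differentiableI by blast+

lemma differentiable_rho: "y \<in> W \<Longrightarrow> rho differentiable (at y)"
  unfolding rho_def[abs_def] by (intro differentiable_mult differentiable_lam differentiable_\<gamma>)

lemma dderiv_rho_lift:
  assumes y: "y \<in> W"
  shows "dderiv rho y (lift X) = 0"
proof (rule dderiv_first_coordinate[OF W y differentiable_rho[OF y]])
  fix z assume z: "z \<in> W" "z$1 = y$1"
  then show "rho z = rho y" using lam_const[OF z(1) y z(2)] by (simp add: rho_def)
qed

lemma dderiv_metric_lift:
  assumes y: "y \<in> W"
  shows "dderiv (\<lambda>q. m.h q (lift X) (lift Y)) y v
    = rho y * dderiv (\<lambda>q. c.h q X Y) (proj y) (proj v) + dderiv rho y v * c.h (proj y) X Y"
proof -
  have D: "((\<lambda>q. rho q * c.h (proj q) X Y) has_derivative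
    (\<lambda>v. rho y * dderiv (\<lambda>q. c.h q X Y) (proj y) (proj v) + dderiv rho y v * c.h (proj y) X Y)) (at y)"
    by (intro has_derivative_mult dderiv_has_derivative differentiable_rho y has_derivative_proj
        c.differentiable_affine_metric W_D)
  have "dderiv (\<lambda>q. m.h q (lift X) (lift Y)) y = dderiv (\<lambda>q. rho q * c.h (proj q) X Y) y"
    by (rule dderiv_cong_open[OF W y metric_simps(4) differentiableI[OF D]])
  then show ?thesis using dderiv_eqI[OF D] by simp
qed

text \<open>The mixed second derivative of \<open>F\<close> differs from its derivative along the
  surface only in having the velocity of the second curve component as factor; it has no normal
  part.\<close>

lemma \<Gamma>_axis_lift:
  assumes y: "y \<in> W"
  shows "m.\<Gamma> y e1 (lift X) = (\<gamma>' (y$1) $ 2 / \<gamma> (y$1) $ 2) *\<^sub>R lift X"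
proof (rule m.tangential_eqI[OF y, where c = 0])
  note q = W_D(2)[OF y]
  have "c.d2 (proj y) 0 X = 0"
    by (rule bilinear_lzero[OF c.bilinear_d2[OF q]])
  then show "m.d2 y e1 (lift X) = dderiv F y ((\<gamma>' (y$1) $ 2 / \<gamma> (y$1) $ 2) *\<^sub>R lift X) + 0 *\<^sub>R \<zeta> y"
    using nonzero(2)[OF y]
    by (simp add: d2F[OF y] dF[OF y] proj_scaleR linear_0[OF c.linear_d\<Phi>[OF q]] linear_cmul[OF c.linear_d\<Phi>[OF q]] axis_nth)
qed

text \<open>Along the curve the metric on lifts varies only through \<open>rho\<close>, and the
  connection acts on lifts by a scalar. This one formula gives both the umbilicity and the vanishing
  mixed coefficient required by \<open>O.rot_commutes_K\<close>.\<close>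

lemma nabla_axis_lift:
  assumes y: "y \<in> W"
  shows "m.nabla_h y e1 (lift X) (lift Y)
    = (dderiv rho y e1 / rho y - 2 * \<gamma>' (y$1) $ 2 / \<gamma> (y$1) $ 2) * m.h y (lift X) (lift Y)"
proof -
  note mb = m.bilinear_affine_metric[OF y]
  have "dderiv (\<lambda>q. c.h q X Y) (proj y) 0 = 0"
    by (rule linear_0[OF linear_dderiv[OF c.differentiable_affine_metric[OF W_D(2)[OF y]]]])
  then show ?thesis
    using rho_nonzero[OF y] nonzero(2)[OF y]
    by (simp add: m.nabla_h_def \<Gamma>_axis_lift[OF y] dderiv_metric_lift[OF y] metric_simps[OF y]
        bilinear_lmul[OF mb] bilinear_rmul[OF mb] field_simps)
qed

text \<open>The square of \<open>e1\<close> depends on the first coordinate only, and the connection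
  maps the pair to a lift, which is orthogonal to \<open>e1\<close>.\<close>

lemma nabla_lift_axis:
  assumes y: "y \<in> W"
  shows "m.nabla_h y (lift X) e1 e1 = 0"
proof -
  note mb = m.bilinear_affine_metric[OF y]
  have "dderiv (\<lambda>q. m.h q e1 e1) y (lift X) = 0"
  proof (rule dderiv_first_coordinate[OF W y m.differentiable_affine_metric[OF y]])
    fix z assume z: "z \<in> W" "z$1 = y$1"
    then show "m.h z e1 e1 = m.h y e1 e1"
      using lam_const[OF z(1) y z(2)] by (simp add: metric_simps y)
  qed
  moreover have "m.\<Gamma> y (lift X) e1 = (\<gamma>' (y$1) $ 2 / \<gamma> (y$1) $ 2) *\<^sub>R lift X"
    using m.\<Gamma>_sym[OF y, of "lift X" e1] \<Gamma>_axis_lift[OF y] by simp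
  ultimately show ?thesis
    by (simp add: m.nabla_h_def metric_simps[OF y]
        bilinear_lmul[OF mb] bilinear_rmul[OF mb])
qed

section \<open>The affine normal and the shape operator\<close>

definition "\<beta> y = c.conormal (proj y) \<bullet> tail (\<zeta> y)"

text \<open>
  Differentiating \<open>\<nu>\<close> along the surface shows that the part of the normal tangent to \<open>\<Phi>\<close> is orthogonal
  to everything; differentiating along the curve gives a linear system for the remaining two
  coefficients whose entries depend on the first coordinate only.
\<close>

lemma dderiv_\<nu>:
  assumes y: "y \<in> W"
  shows "dderiv \<nu> y v = lam y *\<^sub>R emb (- (v$1 * \<gamma>'' (y$1) $ 2))
    (\<gamma>' (y$1) $ 1 *\<^sub>R dderiv c.conormal (proj y) (proj v) + (v$1 * \<gamma>'' (y$1) $ 1) *\<^sub>R c.conormal (proj y))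
    + dderiv lam y v *\<^sub>R \<nu>0 y"
  unfolding \<nu>_def[abs_def]
  by (rule dderiv_eqI[THEN fun_cong])
     (rule has_derivative_scaleR[OF dderiv_has_derivative[OF differentiable_lam[OF y]] has_derivative_\<nu>0[OF y]])

lemma tail_\<zeta>:
  assumes y: "y \<in> W"
  shows "tail (\<zeta> y) = \<beta> y *\<^sub>R \<Phi> (proj y)"
proof -
  define q where "q = proj y"
  have q: "q \<in> V" unfolding q_def by (rule W_D(2)[OF y])
  obtain Z b where tail: "tail (\<zeta> y) = dderiv \<Phi> q Z + b *\<^sub>R \<Phi> q"
    using c.gauss_frame_split[OF q] by blast
  have orth: "dderiv c.conormal q X \<bullet> tail (\<zeta> y) = 0" for X
  proof -
    have "dderiv lam y (lift X) = 0"
      by (rule dderiv_first_coordinate[OF W y differentiable_lam[OF y] lam_const[OF _ y]])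
    then have "lam y * (\<gamma>' (y$1) $ 1 * (dderiv c.conormal q X \<bullet> tail (\<zeta> y))) = 0"
      using m.dderiv_\<nu>_\<xi>[OF y, of "lift X"]
      by (subst (asm) emb_tail[of "\<zeta> y", symmetric]) (simp add: dderiv_\<nu>[OF y] flip: q_def)
    then show ?thesis using lam_nonzero[OF y] nonzero(1)[OF y] by simp
  qed
  \<comment> \<open>The derivative of the conormal is minus the metric on tangent vectors and zero
    on \<open>\<Phi>\<close>, so \<open>orth\<close> speaks about \<open>Z\<close> alone.\<close>
  have "c.h q X Z = 0" for X
    using orth[of X] by (simp add: tail inner_add_right c.dderiv_\<nu>_tangent[OF q] c.dderiv_\<nu>_\<xi>[OF q])
  then have "Z = 0"
    by (intro c_nondegenerate[OF y]) (simp add: c.affine_metric_sym[OF q, of Z] flip: q_def)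
  then have tail: "tail (\<zeta> y) = b *\<^sub>R \<Phi> q"
    by (simp add: tail linear_0[OF c.linear_d\<Phi>[OF q]])
  then have "\<beta> y = b" by (simp add: \<beta>_def c.conormal_\<Phi>[OF q] flip: q_def)
  with tail show ?thesis by (simp add: q_def)
qed

lemma \<zeta>_eq: "y \<in> W \<Longrightarrow> \<zeta> y = emb (\<zeta> y $ 1) (\<beta> y *\<^sub>R \<Phi> (proj y))"
  using emb_tail[of "\<zeta> y"] tail_\<zeta>[of y] by simp

lemma \<zeta>_system:
  assumes y: "y \<in> W"
  shows "\<gamma>' (y$1) $ 1 * \<beta> y - \<gamma>' (y$1) $ 2 * \<zeta> y $ 1 = 1 / lam y"
    and "\<gamma>'' (y$1) $ 1 * \<beta> y - \<gamma>'' (y$1) $ 2 * \<zeta> y $ 1 = - dderiv lam y e1 / (lam y)\<^sup>2"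
proof -
  note q = W_D(2)[OF y]
  have a: "\<nu>0 y \<bullet> \<zeta> y = \<gamma>' (y$1) $ 1 * \<beta> y - \<gamma>' (y$1) $ 2 * \<zeta> y $ 1"
    by (subst \<zeta>_eq[OF y]) (simp add: \<nu>0_def c.conormal_\<Phi>[OF q])
  have b: "\<nu>0 y \<bullet> \<zeta> y = 1 / lam y" by (simp add: lam_def)
  show "\<gamma>' (y$1) $ 1 * \<beta> y - \<gamma>' (y$1) $ 2 * \<zeta> y $ 1 = 1 / lam y"
    using a b by simp
  have "dderiv c.conormal (proj y) 0 = 0"
    by (rule linear_0[OF linear_dderiv[OF c.differentiable_conormal[OF q]]])
  then have "lam y * (\<gamma>'' (y$1) $ 1 * \<beta> y - \<gamma>'' (y$1) $ 2 * \<zeta> y $ 1) + dderiv lam y e1 * (\<nu>0 y \<bullet> \<zeta> y)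
      = dderiv \<nu> y e1 \<bullet> \<zeta> y"
    unfolding dderiv_\<nu>[OF y] inner_add_left inner_scaleR_left
    by (subst (2) \<zeta>_eq[OF y]) (simp add: c.conormal_\<Phi>[OF q] axis_nth)
  then have "lam y * (\<gamma>'' (y$1) $ 1 * \<beta> y - \<gamma>'' (y$1) $ 2 * \<zeta> y $ 1) + dderiv lam y e1 * (1 / lam y) = 0"
    unfolding m.dderiv_\<nu>_\<xi>[OF y] b .
  then show "\<gamma>'' (y$1) $ 1 * \<beta> y - \<gamma>'' (y$1) $ 2 * \<zeta> y $ 1 = - dderiv lam y e1 / (lam y)\<^sup>2"
    using lam_nonzero[OF y] by (simp add: field_simps power2_eq_square)
qed

text \<open>On a slice both points give the same linear system, including the derivative of
  \<open>lam\<close>; its determinant is \<open>wr\<close> up to sign, which is nonzero.\<close>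

lemma \<zeta>_const:
  assumes y: "y \<in> W" "y' \<in> W" "y$1 = y'$1"
  shows "\<zeta> y $ 1 = \<zeta> y' $ 1" "\<beta> y = \<beta> y'"
proof -
  define t where "t = y'$1"
  have "dderiv lam y e1 = dderiv lam y' e1"
    by (rule dderiv_first_coordinate_eq[OF W y differentiable_lam[OF y(1)] differentiable_lam[OF y(2)] lam_const])
  then have
    "\<gamma>' t $ 1 * (\<beta> y - \<beta> y') = \<gamma>' t $ 2 * (\<zeta> y $ 1 - \<zeta> y' $ 1)"
    "\<gamma>'' t $ 1 * (\<beta> y - \<beta> y') = \<gamma>'' t $ 2 * (\<zeta> y $ 1 - \<zeta> y' $ 1)"
    using \<zeta>_system[OF y(1)] \<zeta>_system[OF y(2)] lam_const[OF y] y(3)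
    by (simp_all add: t_def algebra_simps)
  then have "wr t * (\<beta> y - \<beta> y') = 0" "wr t * (\<zeta> y $ 1 - \<zeta> y' $ 1) = 0"
    unfolding wr_def by algebra+
  then show "\<zeta> y $ 1 = \<zeta> y' $ 1" "\<beta> y = \<beta> y'"
    using nonzero(3)[OF y(2)] by (simp_all add: t_def)
qed

text \<open>The coefficients of the normal are constant on slices, so surface directions
  differentiate only \<open>\<Phi>\<close>, while \<open>e1\<close> differentiates only the
  coefficients.\<close>

lemma d\<zeta>:
  assumes y: "y \<in> W"
  shows "dderiv \<zeta> y (lift X) = emb 0 (\<beta> y *\<^sub>R dderiv \<Phi> (proj y) X)"
    and "\<exists>a b. dderiv \<zeta> y e1 = emb a (b *\<^sub>R \<Phi> (proj y))"
proof -
  note q = W_D(2)[OF y]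
  have \<zeta>': "(\<zeta> has_derivative dderiv \<zeta> y) (at y)"
    by (rule dderiv_has_derivative[OF smooth_on_differentiable[OF \<zeta> y]])
  have a: "(\<lambda>y. \<zeta> y $ 1) differentiable (at y)"
    by (rule differentiableI[OF bounded_linear.has_derivative[OF bounded_linear_vec_nth \<zeta>']])
  have b: "\<beta> differentiable (at y)"
    unfolding \<beta>_def[abs_def]
    by (rule differentiableI[OF has_derivative_inner[OF has_derivative_conormal[OF y]
        bounded_linear.has_derivative[OF bounded_linear_tail \<zeta>']]])
  have D: "((\<lambda>y. emb (\<zeta> y $ 1) (\<beta> y *\<^sub>R \<Phi> (proj y))) has_derivative
     (\<lambda>v. emb (dderiv (\<lambda>y. \<zeta> y $ 1) y v) (\<beta> y *\<^sub>R dderiv \<Phi> (proj y) (proj v) + dderiv \<beta> y v *\<^sub>R \<Phi> (proj y)))) (at y)"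
    by (intro has_derivative_emb has_derivative_scaleR dderiv_has_derivative a b has_derivative_\<Phi> y)
  have "dderiv \<zeta> y = dderiv (\<lambda>y. emb (\<zeta> y $ 1) (\<beta> y *\<^sub>R \<Phi> (proj y))) y"
    by (rule dderiv_cong_open[OF W y \<zeta>_eq differentiableI[OF D]])
  then have eq: "dderiv \<zeta> y v = emb (dderiv (\<lambda>y. \<zeta> y $ 1) y v)
      (\<beta> y *\<^sub>R dderiv \<Phi> (proj y) (proj v) + dderiv \<beta> y v *\<^sub>R \<Phi> (proj y))" for v
    using dderiv_eqI[OF D] by simp
  have "dderiv (\<lambda>y. \<zeta> y $ 1) y (lift X) = 0"
    by (rule dderiv_first_coordinate[OF W y a \<zeta>_const(1)[OF _ y]])
  moreover have "dderiv \<beta> y (lift X) = 0"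
    by (rule dderiv_first_coordinate[OF W y b \<zeta>_const(2)[OF _ y]])
  ultimately show "dderiv \<zeta> y (lift X) = emb 0 (\<beta> y *\<^sub>R dderiv \<Phi> (proj y) X)"
    by (simp add: eq)
  show "\<exists>a b. dderiv \<zeta> y e1 = emb a (b *\<^sub>R \<Phi> (proj y))"
    by (auto simp: eq linear_0[OF c.linear_d\<Phi>[OF q]])
qed

lemma shape_lift:
  assumes y: "y \<in> W"
  shows "shape_operator F \<zeta> y (lift X) = (- \<beta> y / \<gamma> (y$1) $ 2) *\<^sub>R lift X"
proof -
  note q = W_D(2)[OF y]
  have "tangential F \<zeta> y (dderiv \<zeta> y (lift X)) = (\<beta> y / \<gamma> (y$1) $ 2) *\<^sub>R lift X"
    using nonzero(2)[OF y]
    by (intro m.tangential_eqI[OF y, where c = 0])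
       (simp add: d\<zeta>[OF y] dF[OF y] proj_scaleR linear_cmul[OF c.linear_d\<Phi>[OF q]])
  then show ?thesis by (simp add: shape_operator_def)
qed

text \<open>The derivative of the normal along \<open>e1\<close> has no part tangent to
  \<open>\<Phi>\<close>; uniqueness in the centroaffine frame then forces the surface component of
  its preimage \<open>T\<close> to vanish.\<close>

lemma shape_axis:
  assumes y: "y \<in> W"
  shows "\<exists>a. shape_operator F \<zeta> y e1 = a *\<^sub>R e1"
proof -
  define T where "T = tangential F \<zeta> y (dderiv \<zeta> y e1)"
  note q = W_D(2)[OF y]
  obtain a b where ab: "dderiv \<zeta> y e1 = emb a (b *\<^sub>R \<Phi> (proj y))" using d\<zeta>(2)[OF y] by blast
  have "dderiv \<zeta> y e1 = dderiv F y T"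
    using m.gauss_frame_split[OF y, of "dderiv \<zeta> y e1"] by (simp add: T_def F_equiaffine[OF y])
  then have "b *\<^sub>R \<Phi> (proj y) = \<gamma> (y$1) $ 2 *\<^sub>R dderiv \<Phi> (proj y) (proj T) + (T$1 * \<gamma>' (y$1) $ 2) *\<^sub>R \<Phi> (proj y)"
    by (simp add: ab dF[OF y])
  then have "dderiv \<Phi> (proj y) (\<gamma> (y$1) $ 2 *\<^sub>R proj T) + (T$1 * \<gamma>' (y$1) $ 2 - b) *\<^sub>R \<Phi> (proj y) = 0"
    by (simp add: linear_cmul[OF c.linear_d\<Phi>[OF q]] algebra_simps)
  from c.gauss_frame_eq_0[OF q this] have "proj T = 0" using nonzero(2)[OF y] by simp
  then have "T = T$1 *\<^sub>R e1" by (rule axis_lift)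
  then show ?thesis
    unfolding shape_operator_def T_def[symmetric] by (metis scaleR_minus_left)
qed

text \<open>In the last three ambient coordinates both the normal and the image of \<open>e1\<close>
  are multiples of \<open>\<Phi>\<close>, which the centroaffine Gauss formula counts as
  transversal. What remains is the connection of the surface.\<close>

lemma proj_\<Gamma>_lift:
  assumes y: "y \<in> W"
  shows "proj (m.\<Gamma> y (lift X) (lift Y)) = c.\<Gamma> (proj y) X Y"
proof -
  define T where "T = m.\<Gamma> y (lift X) (lift Y)"
  define k where "k = transversal F \<zeta> y (m.d2 y (lift X) (lift Y))"
  define g where "g = \<gamma> (y$1) $ 2"
  note q = W_D(2)[OF y]
  have g: "g \<noteq> 0" unfolding g_def by (rule nonzero(2)[OF y])
  have "m.d2 y (lift X) (lift Y) = dderiv F y T + k *\<^sub>R \<zeta> y"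
    unfolding T_def k_def by (rule m.gauss_frame_split[OF y])
  also have "\<dots> = dderiv F y T + k *\<^sub>R emb (\<zeta> y $ 1) (\<beta> y *\<^sub>R \<Phi> (proj y))"
    using \<zeta>_eq[OF y] by simp
  finally have "g *\<^sub>R c.d2 (proj y) X Y
      = g *\<^sub>R dderiv \<Phi> (proj y) (proj T) + (T$1 * \<gamma>' (y$1) $ 2 + k * \<beta> y) *\<^sub>R \<Phi> (proj y)"
    by (simp add: d2F[OF y] dF[OF y] emb_add emb_scaleR algebra_simps flip: g_def)
  then have "(1 / g) *\<^sub>R (g *\<^sub>R c.d2 (proj y) X Y)
      = (1 / g) *\<^sub>R (g *\<^sub>R dderiv \<Phi> (proj y) (proj T) + (T$1 * \<gamma>' (y$1) $ 2 + k * \<beta> y) *\<^sub>R \<Phi> (proj y))"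
    by simp
  then have "c.d2 (proj y) X Y = dderiv \<Phi> (proj y) (proj T) + ((T$1 * \<gamma>' (y$1) $ 2 + k * \<beta> y) / g) *\<^sub>R \<Phi> (proj y)"
    using g by (simp add: scaleR_add_right)
  from c.tangential_eqI[OF q this] show ?thesis by (simp add: T_def)
qed

text \<open>\<open>rho\<close> is constant along the surface, and the block form of the metric
  ignores the \<open>e1\<close> component of the connection.\<close>

lemma nabla_lift:
  assumes y: "y \<in> W"
  shows "m.nabla_h y (lift X) (lift Y) (lift Z) = rho y * c.nabla_h (proj y) X Y Z"
proof -
  have hl: "m.h y v (lift Z) = rho y * c.h (proj y) (proj v) Z" "m.h y (lift Z) v = rho y * c.h (proj y) Z (proj v)" for v Z
    by (simp_all add: metric[OF y])
  show ?thesis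
    unfolding m.nabla_h_def c.nabla_h_def hl proj_\<Gamma>_lift[OF y] dderiv_metric_lift[OF y] dderiv_rho_lift[OF y]
    by (simp add: algebra_simps)
qed

section \<open>The symmetry in one chart\<close>

lemma nondegenerate:
  assumes y: "y \<in> W" and "\<forall>w. m.h y v w = 0"
  shows "v = 0"
  using pos[OF y, of v] assms(2) by auto

text \<open>The axis is the normalized curve direction, and the other frame vectors are lifts of an
  orthonormal pair of the surface. The preceding lemmas verify the hypotheses of
  \<open>O.rot_commutes_K\<close> and \<open>O.rot_commutes_S\<close> in this frame.\<close>

lemma Z3_symmetry:
  assumes y: "y \<in> W"
  shows "\<exists>G \<subseteq> special_isometries (m.h y).
    (\<exists>e. orthonormal_family (m.h y) UNIV e \<and> G = rotation_about (m.h y) e ` {2 * pi * of_int k / 3 | k :: int. True}) \<and>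
    (\<forall>g\<in>G. (\<forall>v w. m.K y (g v) (g w) = g (m.K y v w)) \<and>
      (\<forall>v. shape_operator F \<zeta> y (g v) = g (shape_operator F \<zeta> y v)))"
proof -
  define q where "q = proj y"
  have q: "q \<in> V" unfolding q_def by (rule W_D(2)[OF y])
  define b where "b X Y = rho y * c.h q X Y" for X Y
  note cb = c.bilinear_affine_metric[OF q] and mb = m.bilinear_affine_metric[OF y]
  have b: "bilinear b" using cb unfolding b_def bilinear_def linear_iff by (simp add: algebra_simps)
  have b_sym: "b X Y = b Y X" for X Y by (simp add: b_def c.affine_metric_sym[OF q, of X Y])
  have b_pos: "\<forall>X. X \<noteq> 0 \<longrightarrow> b X X > 0" using rho_pos[OF y] by (simp add: b_def q_def)
  let ?\<Delta> = "b (axis 1 1) (axis 1 1) * b (axis 2 1) (axis 2 1) - (b (axis 1 1) (axis 2 1))\<^sup>2"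
  obtain X Y where XY: "b X X = 1" "b Y Y = 1" "b X Y = 0" "(X$1 * Y$2 - X$2 * Y$1)\<^sup>2 * ?\<Delta> = 1"
    and tr: "\<forall>P. bilinear P \<and> (\<forall>v w. P v w = P w v) \<longrightarrow>
      (P X X + P Y Y) * ?\<Delta> = b (axis 2 1) (axis 2 1) * P (axis 1 1) (axis 1 1)
        - 2 * b (axis 1 1) (axis 2 1) * P (axis 1 1) (axis 2 1) + b (axis 1 1) (axis 1 1) * P (axis 2 1) (axis 2 1)"
    using gram_schmidt_2[OF b b_sym b_pos] by (elim exE conjE) (rule that; assumption)
  note mK = m.difference_tensor[OF y nondegenerate[OF y]]
  note cK = c.difference_tensor[OF q c_nondegenerate[OF y, folded q_def]]
  have trace: "c.nabla_h q Z X X + c.nabla_h q Z Y Y = 0" for Z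
  proof -
    \<comment> \<open>Expressing the cubic form by \<open>c.K\<close> makes its bilinearity visible,
      so that \<open>tr\<close> applies to it.\<close>
    have eq: "c.nabla_h q Z = (\<lambda>v w. - 2 * c.h q (c.K q Z v) w)"
      by (simp add: fun_eq_iff cK(3))
    have "bilinear (c.nabla_h q Z)"
      using cb cK(1) unfolding eq bilinear_def linear_iff by (simp add: algebra_simps)
    then have "bilinear (c.nabla_h q Z) \<and> (\<forall>v w. c.nabla_h q Z v w = c.nabla_h q Z w v)"
      using c.codazzi(2)[OF q] by blast
    from spec[OF tr, THEN mp, OF this] have "(c.nabla_h q Z X X + c.nabla_h q Z Y Y) * ?\<Delta>
       = rho y * (c.h22 q * c.nabla_h q Z (axis 1 1) (axis 1 1) - 2 * c.h12 q * c.nabla_h q Z (axis 1 1) (axis 2 1)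
          + c.h11 q * c.nabla_h q Z (axis 2 1) (axis 2 1))"
      by (simp add: b_def algebra_simps)
    also have "\<dots> = 0"
    proof -
      have "(c.vol q')\<^sup>2 = c.h11 q' * c.h22 q' - (c.h12 q')\<^sup>2" if "q' \<in> V" for q'
      proof -
        \<comment> \<open>Apolarity needs the volume identity on all of \<open>V\<close>, but
          \<open>volumes\<close> speaks of points of \<open>W\<close>; \<open>y'\<close> is the
          point over \<open>q'\<close> in the slice of \<open>y\<close>.\<close>
        define y' where "y' = y$1 *\<^sub>R e1 + lift q'"
        have "proj y' = q'" "y' $ 1 = y $ 1"
          by (simp_all add: y'_def proj_add proj_scaleR axis_nth)
        then show ?thesis using volumes(2)[of y'] that W_D(1)[OF y] by (simp add: W_def)
      qed
      from c.apolarity[OF this q] show ?thesis by simp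
    qed
    finally show ?thesis using XY(4) by auto
  qed
  have "e1 \<noteq> 0" by (simp add: axis_eq_0_iff)
  from pos[OF y this] have h11: "m.h y e1 e1 > 0" .
  define s where "s = 1 / sqrt (m.h y e1 e1)"
  have s: "s * s * m.h y e1 e1 = 1" using h11 by (auto simp: s_def)
  define e :: "3 \<Rightarrow> real^3" where "e i = (if i = 1 then s *\<^sub>R e1 else if i = 2 then lift X else lift Y)" for i
  have e_simps: "e 1 = s *\<^sub>R e1" "e 2 = lift X" "e 3 = lift Y" by (simp_all add: e_def)
  have hh: "m.h y (lift X) (lift X) = 1" "m.h y (lift Y) (lift Y) = 1" "m.h y (lift X) (lift Y) = 0" "m.h y (lift Y) (lift X) = 0"
    using XY(1-3) b_sym[of Y X] by (auto simp: metric_simps[OF y] b_def simp flip: q_def)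
  interpret O: orthonormal_frame "m.h y" e
  proof
    show "m.h y (e i) (e j) = (if i = j then 1 else 0)" for i j
      using exhaust_3[of i] exhaust_3[of j] s hh
      by (auto simp: e_simps bilinear_lmul[OF mb] bilinear_rmul[OF mb] metric_simps(2,3)[OF y])
  qed (use mb m.affine_metric_sym[OF y] in auto)
  let ?S = "shape_operator F \<zeta> y"
  have "?S = (\<lambda>v. - tangential F \<zeta> y (dderiv \<zeta> y v))"
    by (simp add: fun_eq_iff shape_operator_def)
  then have S: "linear ?S"
    using linear_compose_neg[OF linear_compose[OF linear_dderiv[OF smooth_on_differentiable[OF \<zeta> y]] m.linear_tangential[OF y]]]
    by (simp add: o_def)
  obtain a where "?S e1 = a *\<^sub>R e1" using shape_axis[OF y] by blast
  then have Se: "?S (e 1) = a *\<^sub>R e 1" by (simp add: e_simps linear_cmul[OF S])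
  have C: "m.h y (m.K y u v) w = - m.nabla_h y u v w / 2" for u v w
    by (rule mK(3))
  have mK_mul: "m.K y (c *\<^sub>R v) w = c *\<^sub>R m.K y v w" "m.K y v (c *\<^sub>R w) = c *\<^sub>R m.K y v w" for c v w
    using bilinear_lmul[OF mK(1)] bilinear_rmul[OF mK(1)] by auto
  have n0: "m.nabla_h y e1 e1 (lift Z) = 0" for Z
    using nabla_lift_axis[OF y, of Z] m.codazzi(1)[OF y, of "lift Z" e1 e1] m.codazzi(2)[OF y, of e1 "lift Z" e1] by simp
  have K_commute: "m.K y (O.rot \<theta> v) (O.rot \<theta> w) = O.rot \<theta> (m.K y v w)"
    if "\<theta> = 2 * pi * of_int k / 3" for \<theta> v w and k :: int
  proof (rule O.rot_commutes_K)
    show "bilinear (m.K y)" by (rule mK(1))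
    show "m.K y v w = m.K y w v" for v w by (rule mK(2))
    show "m.h y (m.K y u v) w = m.h y (m.K y u w) v" for u v w
      unfolding C m.codazzi(2)[OF y, of u v w] ..
    show "m.h y (m.K y (e 1) (e 1)) (e 2) = 0" "m.h y (m.K y (e 1) (e 1)) (e 3) = 0"
      by (simp_all add: e_simps mK_mul O.h_simps C n0)
    show "m.h y (m.K y (e 1) (e 2)) (e 3) = 0"
      "m.h y (m.K y (e 1) (e 2)) (e 2) = m.h y (m.K y (e 1) (e 3)) (e 3)"
      by (simp_all add: e_simps mK_mul O.h_simps C nabla_axis_lift[OF y] hh)
    have "m.nabla_h y (lift Z) (lift X) (lift X) + m.nabla_h y (lift Z) (lift Y) (lift Y) = rho y * 0" for Z
      unfolding nabla_lift[OF y] trace[of Z, symmetric] by (simp add: q_def distrib_left)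
    note this[of X] this[of Y]
    then show "m.h y (m.K y (e 2) (e 2)) (e 2) + m.h y (m.K y (e 2) (e 3)) (e 3) = 0"
      "m.h y (m.K y (e 3) (e 2)) (e 2) + m.h y (m.K y (e 3) (e 3)) (e 3) = 0"
      unfolding C e_simps by simp_all
    \<comment> \<open>3\<theta> is a multiple of 2 pi, so doubling the angle amounts to reversing
      it.\<close>
    have \<theta>2: "2 * \<theta> = 2 * pi * of_int k - \<theta>" using that by simp
    show "cos (2 * \<theta>) = cos \<theta>" "sin (2 * \<theta>) = - sin \<theta>"
      unfolding \<theta>2 by (simp_all add: cos_diff sin_diff cos_int_2pin sin_int_2pin)
  qed
  show ?thesis
  proof (intro exI conjI ballI allI)
    show "O.rot ` {2 * pi * of_int k / 3 | k :: int. True} \<subseteq> special_isometries (m.h y)"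
      using O.rot_special by auto
    show "orthonormal_family (m.h y) UNIV e"
      by (simp add: orthonormal_family_def O.e)
    fix g assume "g \<in> O.rot ` {2 * pi * of_int k / 3 | k :: int. True}"
    then obtain k :: int where g: "g = O.rot (2 * pi * of_int k / 3)" by blast
    show "m.K y (g v) (g w) = g (m.K y v w)" for v w
      unfolding g by (rule K_commute[OF refl])
    show "?S (g v) = g (?S v)" for v
      unfolding g by (rule O.rot_commutes_S[OF S Se]; unfold e_simps; rule shape_lift[OF y])
  qed simp
qed

end

section \<open>Affine spheres\<close>

text \<open>Passing from the normal to the position vector divides the field by \<open>k\<close>, so
  the transversal coefficient is multiplied by \<open>k\<close> and the splitting stays the
  same.\<close>

lemma gauss_frame_position:
  fixes f \<xi> :: "real^'m \<Rightarrow> real^'n"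
  assumes \<xi>: "\<xi> p = k *\<^sub>R f p" "k \<noteq> 0" and bij: "bij (gauss_frame f \<xi> p)"
  shows "bij (gauss_frame f f p)" and "transversal f f p w = k * transversal f \<xi> p w"
proof -
  have eq: "gauss_frame f f p = gauss_frame f \<xi> p \<circ> (\<lambda>(a, c). (a, c / k))"
    using \<xi> by (auto simp: fun_eq_iff gauss_frame_def)
  have "bij (\<lambda>(a :: real^'m, c). (a, c / k))"
    by (rule o_bij[where g = "\<lambda>(a, c). (a, c * k)"]) (use \<xi>(2) in auto)
  then show b: "bij (gauss_frame f f p)"
    unfolding eq by (rule bij_comp[OF _ bij])
  define a c where "a = tangential f \<xi> p w" and "c = transversal f \<xi> p w"
  have "gauss_frame f \<xi> p (a, c) = w"
    using surj_f_inv_f[OF bij_is_surj[OF bij], of w]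
    by (simp add: a_def c_def tangential_def transversal_def)
  then have "gauss_frame f f p (a, k * c) = w"
    using \<xi> by (simp add: eq)
  then have "inv (gauss_frame f f p) w = (a, k * c)"
    by (rule inv_f_eq[OF bij_is_inj[OF b]])
  then show "transversal f f p w = k * transversal f \<xi> p w"
    by (simp add: transversal_def[of f f] c_def)
qed

lemma affine_metric_commute:
  "open S \<Longrightarrow> p \<in> S \<Longrightarrow> smooth_on S f \<Longrightarrow> affine_metric f \<xi> p v w = affine_metric f \<xi> p w v"
  unfolding affine_metric_def by (subst dderiv_commute) auto

text \<open>The Weingarten formula gives \<open>H\<close> times the identity as shape operator. This
  links the constant of \<open>proper_affine_sphere\<close> to the scaling hypothesis on the mean
  curvature.\<close>

lemma affine_mean_curvature_position:
  fixes f :: "real^'m \<Rightarrow> real^'n"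
  assumes S: "open S" "p \<in> S" and f: "smooth_on S f" and bij: "bij (gauss_frame f \<xi> p)"
    and \<xi>: "\<And>q. q \<in> S \<Longrightarrow> \<xi> q = - H *\<^sub>R f q"
  shows "affine_mean_curvature f \<xi> p = H"
proof -
  note df = smooth_on_differentiable[OF f S(2)]
  have D: "((\<lambda>q. - H *\<^sub>R f q) has_derivative (\<lambda>v. - H *\<^sub>R dderiv f p v)) (at p)"
    by (intro has_derivative_scaleR_right dderiv_has_derivative df)
  have "shape_operator f \<xi> p v = H *\<^sub>R v" for v
  proof -
    have "dderiv \<xi> p = dderiv (\<lambda>q. - H *\<^sub>R f q) p"
      by (rule dderiv_cong_open[OF S \<xi> differentiableI[OF D]])
    then have "dderiv \<xi> p v = gauss_frame f \<xi> p (- H *\<^sub>R v, 0)"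
      unfolding dderiv_eqI[OF D] by (simp add: gauss_frame_def linear_neg linear_cmul linear_dderiv[OF df])
    then have "inv (gauss_frame f \<xi> p) (dderiv \<xi> p v) = (- H *\<^sub>R v, 0)"
      by (intro inv_f_eq[OF bij_is_inj[OF bij]]) simp
    then show ?thesis by (simp add: shape_operator_def tangential_def)
  qed
  then have "trace (matrix (shape_operator f \<xi> p)) = (\<Sum>i\<in>(UNIV :: 'm set). H)"
    by (simp add: trace_def matrix_def axis_nth)
  then show ?thesis by (simp add: affine_mean_curvature_def)
qed

lemma blaschke_hypersurface_subset:
  "blaschke_hypersurface A f \<xi> \<Longrightarrow> B \<subseteq> A \<Longrightarrow> blaschke_hypersurface B f \<xi>"
  unfolding blaschke_hypersurface_def by (rule ballI) (drule bspec, erule subsetD)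

lemma positive_definite_subset:
  "positive_definite A f \<xi> \<Longrightarrow> B \<subseteq> A \<Longrightarrow> positive_definite B f \<xi>"
  unfolding positive_definite_def by (rule ballI) (drule bspec, erule subsetD)

lemma pointwise_rotation_symmetry_charts:
  "(\<And>c. c \<in> A \<Longrightarrow> pointwise_rotation_symmetry \<Theta> {c} f \<xi>) \<Longrightarrow> pointwise_rotation_symmetry \<Theta> A f \<xi>"
  unfolding pointwise_rotation_symmetry_def by (rule ballI) (drule meta_spec, drule meta_mp, assumption, erule bspec, rule singletonI)

text \<open>Here the scaling of the sphere enters: for \<bar>H\<bar> = 1 the centroaffine metric is
  the Blaschke metric up to sign, so vectors of unit square keep unit square, and replacing the
  normal by the position vector does not change the absolute volume.\<close>

lemma warped_chart_symmetry:
  fixes V :: "(real^2) set" and I :: "real set" and x :: "real^2 \<Rightarrow> 'a" and \<phi> \<xi> :: "'a \<Rightarrow> real^3"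
  defines "W \<equiv> {y. y$1 \<in> I \<and> proj y \<in> V}" and "chart \<equiv> (\<lambda>y. (y$1, x (proj y)))"
  assumes V: "open V" and \<phi>: "blaschke_hypersurface {(V, x)} \<phi> \<xi>"
    and \<xi>: "\<And>p. p \<in> V \<Longrightarrow> \<xi> (x p) = - H *\<^sub>R \<phi> (x p)" and H: "\<bar>H\<bar> = 1"
    and I: "open I" and \<gamma>: "smooth_on I \<gamma>"
    and F: "blaschke_hypersurface {(W, chart)} (warped_hypersurface \<gamma> \<phi>) \<eta>"
    and pos: "positive_definite {(W, chart)} (warped_hypersurface \<gamma> \<phi>) \<eta>"
  shows "pointwise_Z3_symmetry {(W, chart)} (warped_hypersurface \<gamma> \<phi>) \<eta>"
proof -
  define \<Phi> where "\<Phi> = \<phi> \<circ> x"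
  define \<zeta> where "\<zeta> = \<eta> \<circ> chart"
  define f where "f = (\<lambda>y. emb (\<gamma> (y$1) $ 1) (\<gamma> (y$1) $ 2 *\<^sub>R \<Phi> (proj y)))"
  have f: "warped_hypersurface \<gamma> \<phi> \<circ> chart = f"
    by (simp add: fun_eq_iff warped_hypersurface_def chart_def f_def emb_def \<Phi>_def)
  note \<phi>' = \<phi>[unfolded blaschke_hypersurface_def, simplified, folded \<Phi>_def]
  note F' = F[unfolded blaschke_hypersurface_def, simplified, unfolded f, folded \<zeta>_def]
  have \<Phi>: "smooth_on V \<Phi>" and fr: "\<And>q. q \<in> V \<Longrightarrow> bij (gauss_frame \<Phi> (\<xi> \<circ> x) q)"
    using \<phi>' by auto
  have \<xi>': "(\<xi> \<circ> x) q = - H *\<^sub>R \<Phi> q" "- H \<noteq> 0" if "q \<in> V" for q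
    using \<xi>[OF that] H by (auto simp: \<Phi>_def)
  interpret c: centroaffine_surface V \<Phi>
    by (unfold_locales) (use V \<Phi> gauss_frame_position(1)[OF \<xi>' fr] in auto)
  have ch: "c.h q X Y = - H * affine_metric \<Phi> (\<xi> \<circ> x) q X Y" if "q \<in> V" for q X Y
    unfolding affine_metric_def by (rule gauss_frame_position(2)[OF \<xi>'[OF that] fr[OF that]])
  have sf: "smooth_on W f" using F' by auto
  have W: "open W"
    unfolding W_def by (rule open_coordinate_product[OF I V])
  have wi: "warped_immersion V \<Phi> I \<gamma> \<zeta>"
  proof (unfold_locales, fold f_def W_def)
    show "bij (gauss_frame f \<zeta> y)" if "y \<in> W" for y using F' that by blast
    show "transversal f \<zeta> y (dderiv \<zeta> y v) = 0" if "y \<in> W" for y v using F' that by blast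
    show "affine_metric f \<zeta> y v v > 0" if "y \<in> W" "v \<noteq> 0" for y v
      using pos[unfolded positive_definite_def, simplified, unfolded f, folded \<zeta>_def] that by blast
    show "smooth_on W \<zeta>" using F' by blast
    show "\<bar>\<Phi> q \<bullet> (dderiv \<Phi> q X \<times> dderiv \<Phi> q Y)\<bar> = 1"
      if q: "q \<in> V" and on: "\<bar>c.h q X X\<bar> = 1" "\<bar>c.h q Y Y\<bar> = 1" "c.h q X Y = 0" for q X Y
    proof -
      \<comment> \<open>Row 3 is reserved for the normal, so the value at index 3 is
        immaterial.\<close>
      define Z where "Z i = (if i = 1 then X else Y)" for i :: 3
      let ?g = "affine_metric \<Phi> (\<xi> \<circ> x) q"
      have "\<bar>?g X X\<bar> = 1" "\<bar>?g Y Y\<bar> = 1" "?g X Y = 0"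
        using on H \<xi>'(2)[OF q] by (simp_all add: ch[OF q] abs_mult)
      moreover from this have "?g Y X = 0"
        using affine_metric_commute[OF V q \<Phi>, of _ X Y] by simp
      ultimately have g: "\<bar>?g (Z 1) (Z 1)\<bar> = 1" "\<bar>?g (Z 2) (Z 2)\<bar> = 1" "?g (Z 1) (Z 2) = 0" "?g (Z 2) (Z 1) = 0"
        by (simp_all add: Z_def)
      have "i = 1 \<or> i = 2" if "i \<in> UNIV - {3}" for i :: 3
        using exhaust_3[of i] that by auto
      then have "orthonormal_family ?g (UNIV - {3}) Z"
        unfolding orthonormal_family_def using g by metis
      then have "\<bar>det (\<chi> i. if i = 3 then \<xi> (x q) else dderiv \<Phi> q (Z i))\<bar> = 1"
        using \<phi>' q by blast
      also have "(\<chi> i. if i = 3 then \<xi> (x q) else dderiv \<Phi> q (Z i))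
          = vector [dderiv \<Phi> q X, dderiv \<Phi> q Y, - H *\<^sub>R \<Phi> q]"
        using \<xi>'(1)[OF q] by (simp add: vec_eq_iff forall_3 Z_def)
      \<comment> \<open>Moving the position vector from the last row to the first is a cyclic
        permutation of three rows and preserves the sign.\<close>
      also have "det \<dots> = - H * (\<Phi> q \<bullet> (dderiv \<Phi> q X \<times> dderiv \<Phi> q Y))"
        unfolding dot_cross_det[symmetric] by (simp add: cross_mult_right) (metis cross_triple inner_commute)
      finally show ?thesis using H by (simp add: abs_mult)
    qed
    show "\<bar>det (vector [dderiv f y X, dderiv f y Y, dderiv f y Z, \<zeta> y])\<bar> = 1"
      if y: "y \<in> W" and on: "affine_metric f \<zeta> y X X = 1" "affine_metric f \<zeta> y Y Y = 1" "affine_metric f \<zeta> y Z Z = 1"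
        "affine_metric f \<zeta> y X Y = 0" "affine_metric f \<zeta> y X Z = 0" "affine_metric f \<zeta> y Y Z = 0" for y X Y Z
    proof -
      define E where "E i = (if i = 1 then X else if i = 2 then Y else Z)" for i :: 4
      have E: "E 1 = X" "E 2 = Y" "E 3 = Z" by (simp_all add: E_def)
      note sym = affine_metric_commute[OF W y sf, of \<zeta>]
      have "orthonormal_family (affine_metric f \<zeta> y) (UNIV - {4}) E"
        unfolding orthonormal_family_def
      proof (intro ballI conjI impI)
        fix i j :: 4 assume i: "i \<in> UNIV - {4}" and j: "j \<in> UNIV - {4}" and "i \<noteq> j"
        then show "affine_metric f \<zeta> y (E i) (E j) = 0"
          using exhaust_4[of i] exhaust_4[of j] on sym[of Y X] sym[of Z X] sym[of Z Y] by (auto simp: E)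
      next
        fix i :: 4 assume "i \<in> UNIV - {4}"
        then show "\<bar>affine_metric f \<zeta> y (E i) (E i)\<bar> = 1"
          using exhaust_4[of i] on by (auto simp: E)
      qed
      then have "\<bar>det (\<chi> i. if i = 4 then \<eta> (chart y) else dderiv f y (E i))\<bar> = 1"
        using F' y by blast
      also have "(\<chi> i. if i = 4 then \<eta> (chart y) else dderiv f y (E i))
          = vector [dderiv f y X, dderiv f y Y, dderiv f y Z, \<zeta> y]"
        by (simp add: vec_eq_iff forall_4 E vector_def \<zeta>_def)
      finally show ?thesis .
    qed
  qed (use I \<gamma> sf in auto)
  show ?thesis
    unfolding pointwise_Z3_symmetry_def pointwise_rotation_symmetry_def Let_def
    by (simp only: ball_simps case_prod_conv f \<zeta>_def[symmetric])
       (intro ballI conjI TrueI; rule warped_immersion.Z3_symmetry[OF wi, folded f_def W_def])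
qed

theorem theorem4p2:
  fixes N :: "'a topology" and A :: "('a, 2) atlas"
    and \<phi> \<xi> :: "'a \<Rightarrow> real^3"
    and I :: "real set" and \<gamma> :: "real \<Rightarrow> real^2"
    and \<eta> :: "real \<times> 'a \<Rightarrow> real^4"
  assumes "smooth_manifold N A"
    and "proper_affine_sphere A \<phi> \<xi>"
    and "\<forall>(V, x)\<in>A. \<forall>p\<in>V. \<bar>affine_mean_curvature (\<phi> \<circ> x) (\<xi> \<circ> x) p\<bar> = 1"
    and "open I" "is_interval I" "smooth_on I \<gamma>"
    and "blaschke_hypersurface (product_atlas I A) (warped_hypersurface \<gamma> \<phi>) \<eta>"
    and "positive_definite (product_atlas I A) (warped_hypersurface \<gamma> \<phi>) \<eta>"
  shows "pointwise_Z3_symmetry (product_atlas I A) (warped_hypersurface \<gamma> \<phi>) \<eta> \<or>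
         pointwise_SO2_symmetry (product_atlas I A) (warped_hypersurface \<gamma> \<phi>) \<eta>"
proof (rule disjI1)
  let ?W = "\<lambda>V. {y. y$1 \<in> I \<and> proj y \<in> V}"
  let ?chart = "\<lambda>x y. (y$1, x (proj y))"
  have atlas: "product_atlas I A = (\<lambda>(V, x). (?W V, ?chart x)) ` A"
    by (simp add: product_atlas_def proj_def)
  obtain H where H: "H \<noteq> 0" and \<xi>: "\<And>V x p. (V, x) \<in> A \<Longrightarrow> p \<in> V \<Longrightarrow> \<xi> (x p) = - H *\<^sub>R \<phi> (x p)"
    and \<phi>: "blaschke_hypersurface A \<phi> \<xi>"
    using assms(2) unfolding proper_affine_sphere_def by fast
  have "pointwise_Z3_symmetry {(?W V, ?chart x)} (warped_hypersurface \<gamma> \<phi>) \<eta>" if Vx: "(V, x) \<in> A" for V x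
  \<comment> \<open>The mean curvature hypothesis yields \<bar>H\<bar> = 1 only at an actual point;
    over an empty chart the symmetry is vacuous.\<close>
  proof (cases "V = {}")
    case True
    then show ?thesis by (simp add: pointwise_Z3_symmetry_def pointwise_rotation_symmetry_def)
  next
    case False
    then obtain p where p: "p \<in> V" by blast
    have V: "open V" using assms(1) Vx unfolding smooth_manifold_def by blast
    have \<phi>V: "blaschke_hypersurface {(V, x)} \<phi> \<xi>"
      using blaschke_hypersurface_subset[OF \<phi>] Vx by simp
    have "affine_mean_curvature (\<phi> \<circ> x) (\<xi> \<circ> x) p = H"
      by (rule affine_mean_curvature_position[OF V p])
         (use \<phi>V \<xi>[OF Vx] p in \<open>auto simp: blaschke_hypersurface_def\<close>)
    then have "\<bar>H\<bar> = 1" using assms(3) Vx p by fastforce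
    have mem: "(?W V, ?chart x) \<in> product_atlas I A" unfolding atlas using Vx by force
    show ?thesis
      using blaschke_hypersurface_subset[OF assms(7)] positive_definite_subset[OF assms(8)] mem
      by (intro warped_chart_symmetry[OF V \<phi>V \<xi>[OF Vx] \<open>\<bar>H\<bar> = 1\<close> assms(4,6)]) simp_all
  qed
  then have "pointwise_Z3_symmetry {c} (warped_hypersurface \<gamma> \<phi>) \<eta>" if "c \<in> product_atlas I A" for c
    using that unfolding atlas by (elim imageE) (simp add: case_prod_beta)
  then show "pointwise_Z3_symmetry (product_atlas I A) (warped_hypersurface \<gamma> \<phi>) \<eta>"
    unfolding pointwise_Z3_symmetry_def by (rule pointwise_rotation_symmetry_charts)
qed

end
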